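(* Let $d = 2$, and let $\mathcal K_g$ ($g \in \mathbb R$) and $\mathcal K = \mathcal K(2)$ be as defined in the context. Then: (i) For each $g \in \mathbb R$, the law of $\mathcal K_g$ is the mixture $\mathbb E\,\mathrm{Poisson}(\Lambda_g)$, where $\mathcal L(\Lambda_g)$ is the conditional distribution of $g - G$ given $g - G > 0$, with $G$ standard Gumbel. That is, $\mathbb P(\mathcal K_g = k) = \mathbb E\left[e^{-\Lambda_g}\Lambda_g^k/k!\right]$ for $k = 0, 1, 2, \dots$. (ii) $\mathcal K = \mathcal K(2)$ has the same distribution as $\mathcal G - 1$, where $\mathcal G$ (with support $\{1,2,\dots\}$) has the Geometric$(1/2)$ distribution.
   Context: For $\mathbf x, \mathbf y \in \mathbb R^2$, $\mathbf x \prec \mathbf y$ (equivalently $\mathbf y \succ \mathbf x$; "$\mathbf x$ is dominated by $\mathbf y$") means $x_1 < y_1$ and $x_2 < y_2$; $z_+ := z_1 + z_2$. A point $\mathbf y$ of a point process $S$ is a maximum of $S$ if $\mathbf y \not\prec \mathbf z$ for all points $\mathbf z$ of $S$. The standard Gumbel distribution has density $g \mapsto e^{-g}\exp(-e^{-g})$ on $\mathbb R$. For $g \in \mathbb R$ let $\mathbf x(g) := (g/2,g/2)$ and let $\mathcal K_g$ be the number of maxima dominated by $\mathbf x(g)$ in a nonhomogeneous Poisson point process in $\mathbb R^2$ with intensity function $\mathbf z \mapsto \mathbf 1(\mathbf z \not\succ \mathbf x(g))\, e^{-z_+}$. The law of $\mathcal K = \mathcal K(2)$ is the mixture $\mathbb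 E\,\mathcal L(\mathcal K_G)$ with $G$ standard Gumbel, i.e. $\mathbb P(\mathcal K = k) = \int_{-\infty}^\infty \mathbb P(\mathcal K_g = k)\, e^{-g}\exp(-e^{-g})\,dg$. *)

theory Defs
  imports "HOL-Probability.Probability"
begin

definition dominated :: "real \<times> real \<Rightarrow> real \<times> real \<Rightarrow> bool" (infix "\<prec>" 50)
  where "x \<prec> y \<longleftrightarrow> fst x < fst y \<and> snd x < snd y"

definition maxima :: "(real \<times> real) set \<Rightarrow> (real \<times> real) set"
  where "maxima S = {y \<in> S. \<forall>z\<in>S. \<not> y \<prec> z}"

definition ecount :: "'a set \<Rightarrow> enat"
  where "ecount A = (if finite A then enat (card A) else \<infinity>)"

text \<open>
  A point process is represented as a locally finite random set of points, its count on a
  set \<open>A\<close> being \<open>ecount (\<Xi> \<omega> \<inter> A)\<close>.  A Poisson process is almost surely without multiple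
  points when its intensity measure is locally finite and has no atoms, as is the case for
  \<open>intensity g\<close> below, so multiplicities need not be recorded.  A set of infinite intensity
  contains infinitely many points almost surely, that is, Poisson with parameter \<open>\<infinity>\<close> is the
  point mass at \<open>\<infinity>\<close>.
\<close>

definition poisson_process ::
    "'w measure \<Rightarrow> (real \<times> real) measure \<Rightarrow> ('w \<Rightarrow> (real \<times> real) set) \<Rightarrow> bool"
  where "poisson_process M \<mu> \<Xi> \<longleftrightarrow>
    prob_space M \<and>
    (\<forall>\<omega>\<in>space M. \<forall>B. bounded B \<longrightarrow> finite (\<Xi> \<omega> \<inter> B)) \<and>
    (\<forall>A\<in>sets borel. (\<lambda>\<omega>. ecount (\<Xi> \<omega> \<inter> A)) \<in> measurable M (count_space UNIV)) \<and>
    (\<forall>A\<in>sets borel. emeasure \<mu> A < \<infinity> \<longrightarrow>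
       (\<forall>k::nat. measure M {\<omega> \<in> space M. ecount (\<Xi> \<omega> \<inter> A) = enat k}
          = exp (- measure \<mu> A) * measure \<mu> A ^ k / fact k)) \<and>
    (\<forall>A\<in>sets borel. emeasure \<mu> A = \<infinity> \<longrightarrow> (AE \<omega> in M. ecount (\<Xi> \<omega> \<inter> A) = \<infinity>)) \<and>
    (\<forall>(n::nat) A. (\<forall>i<n. A i \<in> sets borel) \<longrightarrow> disjoint_family_on A {..<n} \<longrightarrow>
       prob_space.indep_vars M (\<lambda>_. count_space UNIV) (\<lambda>i \<omega>. ecount (\<Xi> \<omega> \<inter> A i)) {..<n})"

definition diag_pt :: "real \<Rightarrow> real \<times> real"
  where "diag_pt g = (g / 2, g / 2)"

definition intensity :: "real \<Rightarrow> (real \<times> real) measure"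
  where "intensity g = density lborel
    (\<lambda>z. ennreal (indicator {z. \<not> diag_pt g \<prec> z} z * exp (- (fst z + snd z))))"

definition num_dominated_maxima :: "real \<Rightarrow> (real \<times> real) set \<Rightarrow> enat"
  where "num_dominated_maxima g S = ecount {y \<in> maxima S. y \<prec> diag_pt g}"

definition gumbel_density :: "real \<Rightarrow> real"
  where "gumbel_density g = exp (- g) * exp (- exp (- g))"

text \<open>The library's \<open>geometric_pmf\<close> counts failures and hence has support \<open>{0, 1, \<dots>}\<close>.\<close>

definition geometric1_pmf :: "real \<Rightarrow> nat pmf"
  where "geometric1_pmf p = map_pmf Suc (geometric_pmf p)"

end

theory Submission
  imports Defs "HOL-Real_Asymp.Real_Asymp"
begin

text \<open>
  Put \<open>u = g/2\<close>.  Among the points to the left of the vertical line through \<open>x(g)\<close>, swept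
  downwards, call a point a record if none of the earlier ones lies further to the right.  The points
  dominated by \<open>x(g)\<close> that are maximal are exactly the records whose height lies between \<open>u\<close> and
  the height \<open>Y\<close> of the highest point to the right of the line.  The record heights form a unit
  rate Poisson process independent of \<open>Y\<close>, so the count is mixed Poisson with parameter
  \<open>u - Y\<close>, and the void probabilities of the right-hand part show that \<open>u - Y\<close> has the law of
  \<open>g - G\<close> given \<open>g - G > 0\<close>.

  To work with counts of finitely many disjoint sets only, the heights are cut into cells of
  length \<open>d\<close>.  In the coordinate \<open>exp (-x)\<close> the extreme points of the cells are independent
  exponential variables, so the events that a cell holds a record are independent with
  probability \<open>1 - exp (-d)\<close> each; the binomial counts converge to the Poisson mixture as \<open>d\<close>
  tends to 0.  Part (ii) is Tonelli's theorem with \<open>E (exp (-G)) = 1\<close>.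
\<close>

section \<open>Records of independent exponential variables\<close>

text \<open>\<open>poisson_process\<close> speaks only of counts on finitely many disjoint Borel
  sets, so it offers no conditioning on \<open>Y\<close>. Instead \<open>Y\<close> enters through
  void events: that it lies in cell i + 1 is a difference of two void events of the right-hand part,
  and such an emptiness condition is absorbed into the law of one of the exponential variables. The
  rates explain the binomial law. In the coordinate \<open>exp (-x)\<close>, measured from the line,
  the rightmost point of a strip with heights from a to b has exponential rate e^(-a) - e^(-b).
  Hence everything left of the line and above level j has total rate C j = e^(-(g/2 - j d)), a
  geometric sequence, and the next cell brings a record with probability (C (j+1) - C j) / C (j+1) =
  1 - e^(-d), whatever j is. The Gumbel law appears because the void probability of the right-hand
  part above g/2 - t is exp (-(e^(-(g-t)) - e^(-g))) = P(G \<le> g - t) / P(G < g). In (ii) this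
  denominator cancels the factor exp (-e^(-g)) of the density at g, and the remaining weight e^(-g)
  factorizes after the shift g = x + s.\<close>

lemma nn_integral_exp_atLeast:
  assumes "c > 0"
  shows "(\<integral>\<^sup>+x. ennreal (exp (- c * x)) * indicator {a..} x \<partial>lborel) = ennreal (exp (- c * a) / c)"
proof -
  have "(\<integral>\<^sup>+x. ennreal (exp (- c * x)) * indicator {a..} x \<partial>lborel)
      = ennreal (0 - (\<lambda>x. - exp (- c * x) / c) a)"
  proof (rule nn_integral_FTC_atLeast)
    show "((\<lambda>x. - exp (- c * x) / c) has_real_derivative exp (- c * x)) (at x)" for x
      using assms by (auto intro!: derivative_eq_intros simp: field_simps)
    show "((\<lambda>x. - exp (- c * x) / c) \<longlongrightarrow> 0) at_top"
      using assms by real_asymp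
  qed auto
  then show ?thesis by simp
qed

context prob_space
begin

text \<open>Void probabilities give closed tails \<open>t \<le> W \<omega>\<close>, while
  \<open>exponential_distributed_iff\<close> asks for \<open>W \<omega> \<le> a\<close>. An atom at
  a is excluded by letting t decrease to a in the bound by the event
  \<open>W \<omega> < t\<close>.\<close>

lemma exponential_distributedI_ge:
  assumes [measurable]: "W \<in> borel_measurable M" and c: "c > 0"
    and W: "\<And>t. t \<ge> 0 \<Longrightarrow> prob {\<omega>\<in>space M. t \<le> W \<omega>} = exp (- c * t)"
  shows "distributed M lborel W (exponential_density c)"
  unfolding exponential_distributed_iff[OF c]
proof (intro conjI allI impI)
  fix a :: real assume a: "a \<ge> 0"
  have lt: "prob {\<omega>\<in>space M. W \<omega> < t} = 1 - exp (- c * t)" if "t \<ge> 0" for t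
  proof -
    have "prob {\<omega>\<in>space M. W \<omega> < t} = 1 - prob {\<omega>\<in>space M. t \<le> W \<omega>}"
      by (subst prob_compl[symmetric]) (auto intro!: arg_cong[where f=prob])
    then show ?thesis using W[OF that] by simp
  qed
  have "prob {\<omega>\<in>space M. W \<omega> \<le> a} \<ge> 1 - exp (- a * c)"
  proof -
    have "prob {\<omega>\<in>space M. W \<omega> < a} \<le> prob {\<omega>\<in>space M. W \<omega> \<le> a}"
      by (intro finite_measure_mono) auto
    then show ?thesis using lt[OF a] by (simp add: mult.commute)
  qed
  moreover have "prob {\<omega>\<in>space M. W \<omega> \<le> a} \<le> 1 - exp (- a * c)"
  proof (rule tendsto_lowerbound)
    show "((\<lambda>t. 1 - exp (- c * t)) \<longlongrightarrow> 1 - exp (- a * c)) (at_right a)"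
      by (auto intro!: tendsto_eq_intros simp: mult.commute)
    show "\<forall>\<^sub>F t in at_right a. prob {\<omega>\<in>space M. W \<omega> \<le> a} \<le> 1 - exp (- c * t)"
      using eventually_at_right_less[of a]
    proof eventually_elim
      case (elim t)
      then have "t \<ge> 0" using a by simp
      have "prob {\<omega>\<in>space M. W \<omega> \<le> a} \<le> prob {\<omega>\<in>space M. W \<omega> < t}"
        using elim by (intro finite_measure_mono) auto
      then show ?case using lt[OF \<open>t \<ge> 0\<close>] by simp
    qed
  qed simp
  ultimately show "prob {\<omega>\<in>space M. W \<omega> \<le> a} = 1 - exp (- a * c)" by simp
qed simp

text \<open>Two competing exponential times: the earlier one has rate c + d, and W is first with
  probability c / (c + d), independently of when. Y may be defective, with mass a on the nonnegative
  reals and the rest below 0; through a the probability of an event of the past can be carried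
  along.\<close>

lemma prob_exponential_first:
  assumes ind: "indep_var borel W borel Y" and c: "c > 0" and d: "d \<ge> 0" and a: "a \<ge> 0" and t: "t \<ge> 0"
    and W: "\<And>t. t \<ge> 0 \<Longrightarrow> prob {\<omega>\<in>space M. t \<le> W \<omega>} = exp (- c * t)"
    and Y: "\<And>t. t \<ge> 0 \<Longrightarrow> prob {\<omega>\<in>space M. t \<le> Y \<omega>} = a * exp (- d * t)"
  shows "prob {\<omega>\<in>space M. t \<le> W \<omega> \<and> W \<omega> \<le> Y \<omega>} = a * (c / (c + d)) * exp (- (c + d) * t)"
proof -
  have [measurable]: "W \<in> borel_measurable M" "Y \<in> borel_measurable M"
    using ind by (auto dest: indep_var_rv1 indep_var_rv2)
  note D = exponential_distributedI_ge[OF _ c W, simplified]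
  interpret Y: prob_space "distr M borel Y" by (rule prob_space_distr) simp
  let ?S = "{p::real\<times>real. t \<le> fst p \<and> fst p \<le> snd p}"
  have [measurable]: "?S \<in> sets (borel \<Otimes>\<^sub>M borel)" 
  proof -
    have "{p \<in> space (borel \<Otimes>\<^sub>M borel). t \<le> fst p \<and> fst p \<le> snd (p::real\<times>real)} \<in> sets (borel \<Otimes>\<^sub>M borel)"
      by measurable
    then show ?thesis by (simp add: space_pair_measure)
  qed
  have "emeasure M {\<omega>\<in>space M. t \<le> W \<omega> \<and> W \<omega> \<le> Y \<omega>}
      = emeasure (distr M (borel \<Otimes>\<^sub>M borel) (\<lambda>\<omega>. (W \<omega>, Y \<omega>))) ?S"
    by (subst emeasure_distr) (auto intro!: arg_cong[where f="emeasure M"])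
  also have "\<dots> = emeasure (distr M borel W \<Otimes>\<^sub>M distr M borel Y) ?S"
    using ind by (simp add: indep_var_distribution_eq)
  \<comment> \<open>With W outermost every section is a tail event of Y, so the defective variable
    needs no density.\<close>
  also have "\<dots> = (\<integral>\<^sup>+w. emeasure (distr M borel Y) (Pair w -` ?S) \<partial>distr M borel W)"
    by (rule Y.emeasure_pair_measure_alt) (simp only: sets_pair_measure_cong[OF sets_distr sets_distr], measurable)
  also have "\<dots> = (\<integral>\<^sup>+w. emeasure M {\<omega>\<in>space M. w \<le> Y \<omega>} * indicator {t..} w \<partial>distr M borel W)"
  proof (rule nn_integral_cong)
    fix w
    have *: "Pair w -` ?S = (if t \<le> w then {w..} else {})" by auto
    have "{\<omega>\<in>space M. w \<le> Y \<omega>} = Y -` {w..} \<inter> space M" by auto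
    then show "emeasure (distr M borel Y) (Pair w -` ?S)
        = emeasure M {\<omega>\<in>space M. w \<le> Y \<omega>} * indicator {t..} w"
      unfolding * by (simp add: emeasure_distr)
  qed
  also have "\<dots> = (\<integral>\<^sup>+w. ennreal (a * exp (- d * w)) * indicator {t..} w \<partial>distr M borel W)"
    using t by (intro nn_integral_cong) (auto simp: emeasure_eq_measure Y indicator_def)
  also have "distr M borel W = density lborel (exponential_density c)"
    using D unfolding distributed_def by (simp cong: distr_cong)
  also have "(\<integral>\<^sup>+w. ennreal (a * exp (- d * w)) * indicator {t..} w \<partial>density lborel (exponential_density c))
     = (\<integral>\<^sup>+w. ennreal (a * c) * (ennreal (exp (- (c + d) * w)) * indicator {t..} w) \<partial>lborel)"
    using t c a
    by (subst nn_integral_density)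
       (auto intro!: nn_integral_cong simp: exponential_density_def indicator_def
          ennreal_mult'[symmetric] exp_add[symmetric] algebra_simps)
  also have "\<dots> = ennreal (a * c) * ennreal (exp (- (c + d) * t) / (c + d))"
    using c d nn_integral_exp_atLeast[of "c + d" t] by (subst nn_integral_cmult) simp_all
  also have "\<dots> = ennreal (a * (c / (c + d)) * exp (- (c + d) * t))"
    using c a d by (subst ennreal_mult[symmetric]) auto
  finally show ?thesis using a c d by (simp add: emeasure_eq_measure)
qed

end

section \<open>Binomial weights and the number of records\<close>

definition binom_prob :: "real \<Rightarrow> nat \<Rightarrow> nat \<Rightarrow> real" where
  "binom_prob p m k = real (m choose k) * p ^ k * (1 - p) ^ (m - k)"

lemma binom_prob_0: "binom_prob p 0 k = (if k = 0 then 1 else 0)"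
  by (simp add: binom_prob_def)

lemma binom_prob_Suc_0: "binom_prob p (Suc m) 0 = (1 - p) * binom_prob p m 0"
  by (simp add: binom_prob_def)

lemma binom_prob_Suc_Suc:
  "binom_prob p (Suc m) (Suc k) = (1 - p) * binom_prob p m (Suc k) + p * binom_prob p m k"
proof (cases "k < m")
  case True
  then have "m - k = Suc (m - Suc k)" by simp
  then show ?thesis by (simp add: binom_prob_def algebra_simps)
next
  case False
  then show ?thesis by (simp add: binom_prob_def binomial_eq_0)
qed

lemma binom_prob_nonneg: "0 \<le> p \<Longrightarrow> p \<le> 1 \<Longrightarrow> 0 \<le> binom_prob p m k"
  by (simp add: binom_prob_def)

lemma binom_prob_le_1:
  assumes "0 \<le> p" "p \<le> 1" shows "binom_prob p m k \<le> 1"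
proof -
  have "binom_prob p m k = pmf (binomial_pmf m p) k"
    using assms by (simp add: binom_prob_def)
  then show ?thesis by (simp add: pmf_le_1)
qed

text \<open>A record is a weak new minimum, small values standing for points far to the right. Index
  0 is compared with but never counted: no point of strip 0 is dominated by x(g).\<close>

definition records :: "(nat \<Rightarrow> real) \<Rightarrow> nat \<Rightarrow> nat set" where
  "records w i = {j\<in>{1..i}. \<forall>l<j. w j \<le> w l}"

lemma finite_records [simp]: "finite (records w i)"
  by (simp add: records_def)

lemma records_0 [simp]: "records w 0 = {}"
  by (simp add: records_def)

lemma records_Suc:
  "records w (Suc i) = (if \<forall>l\<le>i. w (Suc i) \<le> w l then insert (Suc i) (records w i) else records w i)"
  by (auto simp: records_def le_Suc_eq less_Suc_eq_le)

lemma Suc_notin_records [simp]: "Suc i \<notin> records w i"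
  by (simp add: records_def)

lemma card_records_Suc:
  "card (records w (Suc i)) = card (records w i) + (if \<forall>l\<le>i. w (Suc i) \<le> w l then 1 else 0)"
  by (simp add: records_Suc)

lemma records_restrict: "i \<le> n \<Longrightarrow> records (restrict w {..n}) i = records w i"
  by (auto simp: records_def)

text \<open>As a finite sum of indicators of closed comparisons, the number of records is seen to be
  measurable in the coordinates.\<close>

lemma card_records_sum:
  "real (card (records w i)) = (\<Sum>j\<in>{1..i}. if \<forall>l<j. w j \<le> w l then 1 else 0)"
proof -
  have "(\<Sum>j\<in>{1..i}. if \<forall>l<j. w j \<le> w l then 1 else (0::real)) = (\<Sum>j\<in>records w i. 1)"
    unfolding records_def by (subst sum.inter_filter) auto
  then show ?thesis by simp
qed

lemma measurable_card_records:
  "{w\<in>space (Pi\<^sub>M {..i} (\<lambda>_. borel)). card (records w i) = k} \<in> sets (Pi\<^sub>M {..i} (\<lambda>_. borel))"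
proof -
  have "(\<lambda>w. real (card (records w i))) \<in> borel_measurable (Pi\<^sub>M {..i} (\<lambda>_. borel))"
    unfolding card_records_sum
  proof (intro borel_measurable_sum measurable_If borel_measurable_const)
    fix j assume j: "j \<in> {1..i}"
    have "{w\<in>space (Pi\<^sub>M {..i} (\<lambda>_. borel)). \<forall>l\<in>{..<j}. w j \<le> (w l :: real)}
        \<in> sets (Pi\<^sub>M {..i} (\<lambda>_. borel))"
      using j by (intro sets.sets_Collect_finite_All borel_measurable_le measurable_component_singleton) auto
    then show "{w\<in>space (Pi\<^sub>M {..i} (\<lambda>_. borel)). \<forall>l<j. w j \<le> (w l :: real)}
        \<in> sets (Pi\<^sub>M {..i} (\<lambda>_. borel))"
      by (simp only: Ball_def lessThan_iff)
  qed
  then have "{w\<in>space (Pi\<^sub>M {..i} (\<lambda>_. borel)). real (card (records w i)) = real k}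
      \<in> sets (Pi\<^sub>M {..i} (\<lambda>_. borel))"
    by (intro borel_measurable_eq borel_measurable_const)
  then show ?thesis by (simp only: of_nat_eq_iff)
qed

context prob_space
begin

text \<open>The value \<open>-1\<close> encodes the event on the number of records: it makes \<open>t \<le> Y\<close> fail for \<open>t \<ge> 0\<close>.\<close>

lemma indep_var_records:
  assumes ind: "indep_vars (\<lambda>_. borel) W {..Suc i}"
  shows "indep_var borel (W (Suc i)) borel
    (\<lambda>\<omega>. if card (records (\<lambda>j. W j \<omega>) i) = k then Min ((\<lambda>j. W j \<omega>) ` {..i}) else - 1 :: real)"
proof -
  let ?f = "\<lambda>w. if card (records w i) = k then Min (w ` {..i}) else - 1 :: real"
  have f: "?f \<in> borel_measurable (Pi\<^sub>M {..i} (\<lambda>_. borel))"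
    by (intro measurable_If borel_measurable_Min borel_measurable_const measurable_card_records
      measurable_component_singleton finite_atMost)
  have "indep_var
    borel ((\<lambda>f. f (Suc i)) \<circ> (\<lambda>\<omega>. restrict (\<lambda>j. W j \<omega>) {Suc i}))
    borel (?f \<circ> (\<lambda>\<omega>. restrict (\<lambda>j. W j \<omega>) {..i}))"
    by (intro indep_var_compose[OF indep_var_restrict[OF ind]] f) auto
  also have "((\<lambda>f. f (Suc i)) \<circ> (\<lambda>\<omega>. restrict (\<lambda>j. W j \<omega>) {Suc i})) = W (Suc i)"
    by auto
  also have "(?f \<circ> (\<lambda>\<omega>. restrict (\<lambda>j. W j \<omega>) {..i}))
      = (\<lambda>\<omega>. if card (records (\<lambda>j. W j \<omega>) i) = k then Min ((\<lambda>j. W j \<omega>) ` {..i}) else - 1)"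
    by (simp add: fun_eq_iff records_restrict)
  finally show ?thesis .
qed

text \<open>The variable \<open>W 0\<close> may be negative; \<open>v\<close> is the probability that it is not.\<close>

lemma prob_records:
  fixes W :: "nat \<Rightarrow> 'a \<Rightarrow> real"
  assumes ind: "indep_vars (\<lambda>_. borel) W {..n}"
    and p: "0 < p" "p < 1"
    and C0: "C 0 > 0" and C_Suc: "\<And>j. C j = (1 - p) * C (Suc j)"
    and W0: "\<And>t. t \<ge> 0 \<Longrightarrow> prob {\<omega>\<in>space M. t \<le> W 0 \<omega>} = v * exp (- C 0 * t)"
    and W: "\<And>j t. j < n \<Longrightarrow> t \<ge> 0 \<Longrightarrow>
      prob {\<omega>\<in>space M. t \<le> W (Suc j) \<omega>} = exp (- (C (Suc j) - C j) * t)"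
    and "i \<le> n" "t \<ge> 0"
  shows "prob {\<omega>\<in>space M. (\<forall>j\<le>i. t \<le> W j \<omega>) \<and> card (records (\<lambda>j. W j \<omega>) i) = k}
    = v * exp (- C i * t) * binom_prob p i k"
  using \<open>i \<le> n\<close> \<open>t \<ge> 0\<close>
\<comment> \<open>The next value is compared with the running minimum, so the induction has to carry
  the joint law of minimum and count, that is, all t at once. The void probabilities later take t =
  0.\<close>
proof (induction i arbitrary: t k)
  case 0
  then show ?case
    using W0[of t] by (auto simp: binom_prob_0)
next
  case (Suc i)
  have v: "v \<ge> 0" using W0[of 0] measure_nonneg[of M "{\<omega>\<in>space M. 0 \<le> W 0 \<omega>}"] by simp
  have Cpos: "C j > 0" for j
  proof (induction j)
    case (Suc j)
    then show ?case using C_Suc[of j] p by (simp add: zero_less_mult_iff)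
  qed (use C0 in simp)
  \<comment> \<open>The rate of the new variable is the fraction p of the new total rate; this is
    where the record probability p comes from.\<close>
  have rec_p: "C (Suc i) - C i = p * C (Suc i)" using C_Suc[of i] by (simp add: algebra_simps)
  define Y where "Y k \<omega> = (if card (records (\<lambda>j. W j \<omega>) i) = k
      then Min ((\<lambda>j. W j \<omega>) ` {..i}) else - 1 :: real)" for k \<omega>
  have indY: "indep_var borel (W (Suc i)) borel (Y k)" for k
    unfolding Y_def using Suc.prems by (intro indep_var_records indep_vars_subset[OF ind]) auto
  have [measurable]: "W (Suc i) \<in> borel_measurable M" "Y k \<in> borel_measurable M" for k
    using indY[of k] by (auto dest: indep_var_rv1 indep_var_rv2)
  have Y_ge: "t \<le> Y k \<omega> \<longleftrightarrow> (\<forall>j\<le>i. t \<le> W j \<omega>) \<and> card (records (\<lambda>j. W j \<omega>) i) = k"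
    if "t \<ge> 0" for t k \<omega>
    using that by (auto simp: Y_def)
  have PY: "prob {\<omega>\<in>space M. t \<le> Y k \<omega>} = (v * binom_prob p i k) * exp (- C i * t)"
    if "t \<ge> 0" for t k
    unfolding Y_ge[OF that] using Suc.IH[of t k] Suc.prems that by (simp add: mult_ac)
  \<comment> \<open>\<open>E k\<close> asks for k records so far and all values at least t;
    \<open>F k\<close> asks in addition that the new value be a record. Their probabilities differ
    by the factor p for every t and k: a new record is independent of the past count and of the
    minimum reached.\<close>
  define F where "F k = {\<omega>\<in>space M. t \<le> W (Suc i) \<omega> \<and> W (Suc i) \<omega> \<le> Y k \<omega>}" for k
  define E where "E k = {\<omega>\<in>space M. t \<le> W (Suc i) \<omega> \<and> t \<le> Y k \<omega>}" for k
  have [measurable]: "F k \<in> events" "E k \<in> events" for k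
    unfolding F_def E_def by measurable
  have PF: "prob (F k) = v * exp (- C (Suc i) * t) * (p * binom_prob p i k)" for k
  proof -
    have "prob (F k) = v * binom_prob p i k * ((C (Suc i) - C i) / (C (Suc i) - C i + C i))
        * exp (- (C (Suc i) - C i + C i) * t)"
      unfolding F_def
    proof (rule prob_exponential_first[OF indY])
      show "0 < C (Suc i) - C i" using rec_p p Cpos[of "Suc i"] by simp
      show "0 \<le> C i" using Cpos[of i] by simp
      show "0 \<le> v * binom_prob p i k" using v p by (simp add: binom_prob_nonneg)
      show "prob {\<omega>\<in>space M. t \<le> W (Suc i) \<omega>} = exp (- (C (Suc i) - C i) * t)" if "0 \<le> t" for t
        using W[of i t] Suc.prems(1) that by (metis Suc_le_lessD)
    qed (fact PY Suc.prems(2))+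
    also have "C (Suc i) - C i + C i = C (Suc i)" by simp
    also have "(C (Suc i) - C i) / C (Suc i) = p" using rec_p Cpos[of "Suc i"] by simp
    finally show ?thesis by simp
  qed
  have PE: "prob (E k) = v * exp (- C (Suc i) * t) * binom_prob p i k" for k
  proof -
    have "prob (E k) = prob {\<omega>\<in>space M. t \<le> W (Suc i) \<omega>} * prob {\<omega>\<in>space M. t \<le> Y k \<omega>}"
      unfolding E_def using prob_indep_random_variable[OF indY, of "{t..}" "{t..}"] by simp
    also have "\<dots> = v * binom_prob p i k * (exp (- (C (Suc i) - C i) * t) * exp (- C i * t))"
      using W[of i t] PY[of t k] Suc.prems by simp
    also have "exp (- (C (Suc i) - C i) * t) * exp (- C i * t) = exp (- C (Suc i) * t)"
      unfolding exp_add[symmetric] by (simp add: algebra_simps)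
    finally show ?thesis by simp
  qed
  have FE: "F k \<subseteq> E k" for k by (auto simp: F_def E_def)
  have W_le: "W (Suc i) \<omega> \<le> Y k \<omega> \<longleftrightarrow>
      (\<forall>l\<le>i. W (Suc i) \<omega> \<le> W l \<omega>) \<and> card (records (\<lambda>j. W j \<omega>) i) = k"
    if "t \<le> W (Suc i) \<omega>" for \<omega> k
    using Y_ge[of "W (Suc i) \<omega>" k \<omega>] that Suc.prems by simp
  have E_eq: "E k = {\<omega>\<in>space M. t \<le> W (Suc i) \<omega> \<and> (\<forall>j\<le>i. t \<le> W j \<omega>)
      \<and> card (records (\<lambda>j. W j \<omega>) i) = k}" for k
    unfolding E_def Y_ge[OF Suc.prems(2)] by blast
  have F_eq: "F k = {\<omega>\<in>space M. t \<le> W (Suc i) \<omega> \<and> (\<forall>l\<le>i. W (Suc i) \<omega> \<le> W l \<omega>)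
      \<and> card (records (\<lambda>j. W j \<omega>) i) = k}" for k
    unfolding F_def using W_le by blast
  define A where "A \<omega> \<longleftrightarrow> (\<forall>l\<le>i. W (Suc i) \<omega> \<le> W l \<omega>)" for \<omega>
  have A_ge: "(\<forall>j\<le>i. t \<le> W j \<omega>)" if "A \<omega>" "t \<le> W (Suc i) \<omega>" for \<omega>
    using that unfolding A_def by (meson order_trans)
  let ?E' = "{\<omega>\<in>space M. (\<forall>j\<le>Suc i. t \<le> W j \<omega>) \<and> card (records (\<lambda>j. W j \<omega>) (Suc i)) = k}"
  have E'_eq: "?E' = {\<omega>\<in>space M. t \<le> W (Suc i) \<omega> \<and> (\<forall>j\<le>i. t \<le> W j \<omega>)
      \<and> card (records (\<lambda>j. W j \<omega>) i) + (if A \<omega> then 1 else 0) = k}"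
  proof -
    have "(\<forall>j\<le>Suc i. P j) \<longleftrightarrow> P (Suc i) \<and> (\<forall>j\<le>i. P j)" for P
      by (auto simp: le_Suc_eq)
    then show ?thesis unfolding card_records_Suc A_def by simp
  qed
  show ?case
  proof (cases k)
    case 0
    have "?E' = E k - F k"
      unfolding E'_eq E_eq F_eq A_def[symmetric] unfolding 0 by (auto split: if_splits)
    then have "prob ?E' = prob (E k) - prob (F k)"
      using FE by (simp add: finite_measure_Diff)
    then show ?thesis by (simp add: PE PF 0 binom_prob_Suc_0 algebra_simps)
  next
    case (Suc k')
    \<comment> \<open>k records arise from k earlier ones without a new record or from k' = k - 1
      earlier ones with a new record, which is the recursion of the binomial weights.\<close>
    have "?E' = (E k - F k) \<union> F k'"
      unfolding E'_eq E_eq F_eq A_def[symmetric] unfolding Suc using A_ge by (auto split: if_splits)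
    moreover have "(E k - F k) \<inter> F k' = {}"
      unfolding E_eq F_eq unfolding Suc by auto
    ultimately have "prob ?E' = prob (E k) - prob (F k) + prob (F k')"
      using FE by (simp add: finite_measure_Union finite_measure_Diff)
    then show ?thesis by (simp add: PE PF Suc binom_prob_Suc_Suc algebra_simps)
  qed
qed

end

section \<open>The intensity measure\<close>

text \<open>One factor of the density e^(-z_+), so that rectangles outside the removed quadrant have
  product mass.\<close>

definition exp_measure :: "real measure" where
  "exp_measure = density lborel (\<lambda>x. ennreal (exp (- x)))"

lemma space_exp_measure [simp]: "space exp_measure = UNIV"
  and sets_exp_measure [simp, measurable_cong]: "sets exp_measure = sets borel"
  by (simp_all add: exp_measure_def)

lemma emeasure_exp_measure:
  "A \<in> sets borel \<Longrightarrow> emeasure exp_measure A = (\<integral>\<^sup>+x. ennreal (exp (- x)) * indicator A x \<partial>lborel)"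
  unfolding exp_measure_def by (subst emeasure_density) auto

lemma exp_measure_atLeast: "emeasure exp_measure {a..} = ennreal (exp (- a))"
  using nn_integral_exp_atLeast[of 1 a] by (simp add: emeasure_exp_measure)

lemma exp_measure_cong:
  assumes "A \<in> sets borel" "B \<in> sets borel" "finite (A - B)" "finite (B - A)"
  shows "emeasure exp_measure A = emeasure exp_measure B"
proof -
  have "AE x in lborel. x \<notin> (A - B) \<union> (B - A)"
    using assms by (intro AE_not_in) (simp add: finite_imp_null_set_lborel)
  then show ?thesis using assms unfolding emeasure_exp_measure[OF assms(1)] emeasure_exp_measure[OF assms(2)]
    by (intro nn_integral_cong_AE) (auto simp: indicator_def)
qed

lemma exp_measure_greaterThan: "emeasure exp_measure {a<..} = ennreal (exp (- a))"
proof -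
  have "{a<..} - {a..} \<subseteq> {a}" "{a..} - {a<..} \<subseteq> {a}" by auto
  then show ?thesis unfolding exp_measure_atLeast[symmetric]
    by (intro exp_measure_cong) (auto intro: finite_subset)
qed

lemma exp_measure_atLeastLessThan:
  assumes "a \<le> b" shows "emeasure exp_measure {a..<b} = ennreal (exp (- a) - exp (- b))"
proof -
  have "{a..<b} = {a..} - {b..}" by auto
  then have "emeasure exp_measure {a..<b} = emeasure exp_measure {a..} - emeasure exp_measure {b..}"
    using assms by (simp add: emeasure_Diff exp_measure_atLeast)
  then show ?thesis by (simp add: exp_measure_atLeast ennreal_minus)
qed

lemma exp_measure_greaterThanAtMost:
  assumes "a \<le> b" shows "emeasure exp_measure {a<..b} = ennreal (exp (- a) - exp (- b))"
proof -
  have "{a<..b} - {a..<b} \<subseteq> {b}" "{a..<b} - {a<..b} \<subseteq> {a}" by auto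
  then show ?thesis
    unfolding exp_measure_atLeastLessThan[OF assms, symmetric]
    by (intro exp_measure_cong) (auto intro: finite_subset)
qed

lemma exp_measure_atLeastAtMost:
  assumes "a \<le> b" shows "emeasure exp_measure {a..b} = ennreal (exp (- a) - exp (- b))"
proof -
  have "{a..b} - {a..<b} \<subseteq> {b}" "{a..<b} - {a..b} = {}" by auto
  then show ?thesis
    unfolding exp_measure_atLeastLessThan[OF assms, symmetric]
    by (intro exp_measure_cong) (auto intro: finite_subset)
qed

lemma exp_measure_lessThan: "emeasure exp_measure {..<a} = \<infinity>"
proof -
  have "ennreal r \<le> emeasure exp_measure {..<a}" if "r \<ge> 0" for r
  proof -
    \<comment> \<open>The left end \<open>- ln (r + exp (- a))\<close> is the one for which the
      interval up to a has mass exactly r.\<close>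
    have "ennreal r = ennreal (exp (- (- ln (r + exp (- a)))) - exp (- a))"
      using that by (simp add: add_nonneg_pos)
    also have "\<dots> = emeasure exp_measure {- ln (r + exp (- a))..<a}"
    proof (rule exp_measure_atLeastLessThan[symmetric])
      have "ln (exp (- a)) \<le> ln (r + exp (- a))" using that by (subst ln_le_cancel_iff) (auto intro: add_nonneg_pos)
      then show "- ln (r + exp (- a)) \<le> a" by simp
    qed
    also have "\<dots> \<le> emeasure exp_measure {..<a}" by (intro emeasure_mono) auto
    finally show ?thesis .
  qed
  note ge = this
  show ?thesis
  proof (cases "emeasure exp_measure {..<a}" rule: ennreal_cases)
    case (real r)
    with ge[of "r + 1"] have "ennreal (r + 1) \<le> ennreal r" by simp
    then show ?thesis using real by (subst (asm) ennreal_le_iff) auto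
  qed simp
qed

lemma exp_measure_atMost: "emeasure exp_measure {..a} = \<infinity>"
proof -
  have "emeasure exp_measure {..<a} \<le> emeasure exp_measure {..a}" by (intro emeasure_mono) auto
  then show ?thesis by (simp add: exp_measure_lessThan top_unique)
qed

lemma borel_Times2 [intro]:
  fixes A B :: "real set"
  assumes "A \<in> sets borel" "B \<in> sets borel" shows "A \<times> B \<in> sets borel"
proof -
  have "A \<times> B \<in> sets (borel \<Otimes>\<^sub>M borel)" using assms by (rule pair_measureI)
  then show ?thesis by (simp only: borel_prod)
qed

lemma dominated_sets: "{z. a \<prec> z} \<in> sets borel" "{z. z \<prec> a} \<in> sets borel"
proof -
  have "{z. a \<prec> z} = {fst a<..} \<times> {snd a<..}" "{z. z \<prec> a} = {..<fst a} \<times> {..<snd a}"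
    by (auto simp: dominated_def)
  then show "{z. a \<prec> z} \<in> sets borel" "{z. z \<prec> a} \<in> sets borel" by (auto simp only: borel_Times2 greaterThan_borel lessThan_borel)
qed

lemma emeasure_intensity:
  assumes "S \<in> sets borel"
  shows "emeasure (intensity g) S
    = (\<integral>\<^sup>+z. ennreal (exp (- fst z)) * ennreal (exp (- snd z)) * indicator (S - {z. diag_pt g \<prec> z}) z \<partial>lborel)"
proof -
  have c: "{z. \<not> diag_pt g \<prec> z} \<in> sets borel"
    using dominated_sets(1)[of "diag_pt g"] sets.compl_sets[of _ borel] by (simp add: Collect_neg_eq Compl_eq_Diff_UNIV)
  have "emeasure (intensity g) S = (\<integral>\<^sup>+z. ennreal (indicator {z. \<not> diag_pt g \<prec> z} z * exp (- (fst z + snd z))) * indicator S z \<partial>lborel)"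
    unfolding intensity_def
  proof (rule emeasure_density)
    show "(\<lambda>z. ennreal (indicator {z. \<not> diag_pt g \<prec> z} z * exp (- (fst z + snd z)))) \<in> borel_measurable lborel"
      using c by (intro measurable_compose[OF _ measurable_ennreal] borel_measurable_times borel_measurable_indicator)
        (auto intro!: borel_measurable_continuous_onI continuous_intros simp del: minus_add_distrib)
  qed (use assms in simp)
  also have "\<dots> = (\<integral>\<^sup>+z. ennreal (exp (- fst z)) * ennreal (exp (- snd z)) * indicator (S - {z. diag_pt g \<prec> z}) z \<partial>lborel)"
    by (intro nn_integral_cong) (auto simp: indicator_def exp_add[symmetric] ennreal_mult[symmetric])
  finally show ?thesis .
qed

lemma nn_integral_exp_Times:
  fixes A B :: "real set"
  assumes [measurable]: "A \<in> sets borel" "B \<in> sets borel"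
  shows "(\<integral>\<^sup>+z. ennreal (exp (- fst z)) * ennreal (exp (- snd z)) * indicator (A \<times> B) z \<partial>lborel)
    = emeasure exp_measure A * emeasure exp_measure B"
proof -
  have "(\<integral>\<^sup>+z. ennreal (exp (- fst z)) * ennreal (exp (- snd z)) * indicator (A \<times> B) z \<partial>lborel)
      = (\<integral>\<^sup>+z. (ennreal (exp (- fst z)) * indicator A (fst z)) * (ennreal (exp (- snd z)) * indicator B (snd z))
          \<partial>(lborel \<Otimes>\<^sub>M lborel))"
    unfolding lborel_prod by (intro nn_integral_cong) (auto simp: indicator_def)
  also have "\<dots> = (\<integral>\<^sup>+x. \<integral>\<^sup>+y. (ennreal (exp (- x)) * indicator A x) * (ennreal (exp (- y)) * indicator B y) \<partial>lborel \<partial>lborel)"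
    by (subst lborel.nn_integral_fst[symmetric]) (auto intro!: nn_integral_cong)
  also have "\<dots> = (\<integral>\<^sup>+x. (ennreal (exp (- x)) * indicator A x) * emeasure exp_measure B \<partial>lborel)"
    by (intro nn_integral_cong) (simp add: nn_integral_cmult emeasure_exp_measure)
  also have "\<dots> = emeasure exp_measure A * emeasure exp_measure B"
    by (simp add: nn_integral_multc emeasure_exp_measure)
  finally show ?thesis .
qed

text \<open>The set S need not itself be the rectangle: to the right of the line the removed
  quadrant truncates the heights at g/2, and only what is left has to be a product.\<close>

lemma emeasure_intensity_Times:
  assumes "A \<in> sets borel" "B \<in> sets borel" "S \<in> sets borel"
    and "S - {z. diag_pt g \<prec> z} = A \<times> B"
  shows "emeasure (intensity g) S = emeasure exp_measure A * emeasure exp_measure B"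
  using nn_integral_exp_Times[OF assms(1,2)] by (simp only: emeasure_intensity[OF assms(3)] assms(4))

lemma emeasure_intensity_Times_le:
  assumes "A \<in> sets borel" "B \<in> sets borel"
  shows "emeasure (intensity g) (A \<times> B) \<le> emeasure exp_measure A * emeasure exp_measure B"
  unfolding nn_integral_exp_Times[OF assms, symmetric] emeasure_intensity[OF borel_Times2[OF assms]]
  by (intro nn_integral_mono mult_mono) (auto simp: indicator_def)

lemma sets_intensity [simp]: "sets (intensity g) = sets borel"
  by (simp add: intensity_def)

section \<open>Poisson processes\<close>

lemma ecount_eq_0_iff [simp]: "ecount A = 0 \<longleftrightarrow> A = {}"
  by (auto simp: ecount_def zero_enat_def)

lemma ecount_eq_enat_iff: "ecount A = enat k \<longleftrightarrow> finite A \<and> card A = k"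
  by (auto simp: ecount_def)

lemma ecount_eq_infinity_iff: "ecount A = \<infinity> \<longleftrightarrow> infinite A"
  by (auto simp: ecount_def)

locale poisson_points =
  fixes M :: "'w measure" and \<mu> :: "(real \<times> real) measure" and \<Xi> :: "'w \<Rightarrow> (real \<times> real) set"
  assumes pp: "poisson_process M \<mu> \<Xi>"
begin

sublocale prob_space M
  using pp by (simp add: poisson_process_def)

lemma finite_points: "\<omega> \<in> space M \<Longrightarrow> bounded B \<Longrightarrow> finite (\<Xi> \<omega> \<inter> B)"
  using pp by (simp add: poisson_process_def)

lemma measurable_ecount [measurable]:
  "A \<in> sets borel \<Longrightarrow> (\<lambda>\<omega>. ecount (\<Xi> \<omega> \<inter> A)) \<in> measurable M (count_space UNIV)"
  using pp by (simp add: poisson_process_def)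

lemma sets_ecount:
  assumes "A \<in> sets borel"
  shows "{\<omega>\<in>space M. P (ecount (\<Xi> \<omega> \<inter> A))} \<in> events"
  using measurable_sets[OF measurable_ecount[OF assms], of "{n. P n}"] by (simp add: vimage_def Int_def conj_commute)

lemma sets_empty: "A \<in> sets borel \<Longrightarrow> {\<omega>\<in>space M. \<Xi> \<omega> \<inter> A = {}} \<in> events"
  using sets_ecount[of A "\<lambda>n. n = 0"] by simp

lemma prob_ecount:
  assumes "A \<in> sets borel" "emeasure \<mu> A = ennreal c" "c \<ge> 0"
  shows "prob {\<omega>\<in>space M. ecount (\<Xi> \<omega> \<inter> A) = enat k} = exp (- c) * c ^ k / fact k"
proof -
  have "measure \<mu> A = c" using assms by (simp add: measure_def)
  moreover have "emeasure \<mu> A < \<infinity>" using assms by simp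
  moreover have "\<forall>A\<in>sets borel. emeasure \<mu> A < \<infinity> \<longrightarrow>
       (\<forall>k::nat. prob {\<omega> \<in> space M. ecount (\<Xi> \<omega> \<inter> A) = enat k}
          = exp (- measure \<mu> A) * measure \<mu> A ^ k / fact k)"
    using pp unfolding poisson_process_def by (elim conjE)
  ultimately show ?thesis using assms(1) by simp
qed

lemma prob_empty:
  assumes "A \<in> sets borel" "emeasure \<mu> A = ennreal c" "c \<ge> 0"
  shows "prob {\<omega>\<in>space M. \<Xi> \<omega> \<inter> A = {}} = exp (- c)"
  using prob_ecount[OF assms, of 0] by (simp flip: zero_enat_def)

lemma AE_infinite:
  assumes "A \<in> sets borel" "emeasure \<mu> A = \<infinity>"
  shows "AE \<omega> in M. infinite (\<Xi> \<omega> \<inter> A)"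
proof -
  have "\<forall>A\<in>sets borel. emeasure \<mu> A = \<infinity> \<longrightarrow> (AE \<omega> in M. ecount (\<Xi> \<omega> \<inter> A) = \<infinity>)"
    using pp unfolding poisson_process_def by (elim conjE)
  then have "AE \<omega> in M. ecount (\<Xi> \<omega> \<inter> A) = \<infinity>" using assms by simp
  then show ?thesis by (simp add: ecount_eq_infinity_iff)
qed

text \<open>Local finiteness covers bounded sets only, while the right-hand parts are unbounded.
  Here finiteness comes from the Poisson weights summing to 1, which leaves no probability for an
  infinite count.\<close>

lemma AE_finite:
  assumes A: "A \<in> sets borel" and "emeasure \<mu> A < \<infinity>"
  shows "AE \<omega> in M. finite (\<Xi> \<omega> \<inter> A)"
proof -
  obtain c where c: "c \<ge> 0" "emeasure \<mu> A = ennreal c"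
    using assms(2) by (cases "emeasure \<mu> A" rule: ennreal_cases) auto
  let ?E = "\<lambda>k. {\<omega>\<in>space M. ecount (\<Xi> \<omega> \<inter> A) = enat k}"
  have E: "?E k \<in> events" for k by (rule sets_ecount[OF A])
  have "(\<lambda>k. prob (?E k)) sums prob (\<Union>k. ?E k)"
    using E by (intro finite_measure_UNION) (auto simp: disjoint_family_on_def)
  moreover have "(\<lambda>k. exp (- c) * (c ^ k / fact k)) sums (exp (- c) * exp c)"
    using exp_converges[of c] by (intro sums_mult) (simp add: divide_inverse mult.commute)
  ultimately have "prob (\<Union>k. ?E k) = 1"
    using sums_unique2 unfolding prob_ecount[OF A c(2,1)] by (fastforce simp: exp_minus)
  then have "AE \<omega> in M. \<omega> \<in> (\<Union>k. ?E k)"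
    using E by (subst prob_eq_1[symmetric]) auto
  then show ?thesis by eventually_elim (auto simp: ecount_eq_enat_iff)
qed

lemma AE_empty:
  assumes A: "A \<in> sets borel" and "emeasure \<mu> A = 0"
  shows "AE \<omega> in M. \<Xi> \<omega> \<inter> A = {}"
proof -
  have "prob {\<omega>\<in>space M. \<Xi> \<omega> \<inter> A = {}} = 1"
    using prob_empty[OF A, of 0] assms(2) by simp
  then show ?thesis using sets_empty[OF A] by (subst (asm) prob_eq_1) auto
qed

text \<open>From e^(-b) \<ge> 1 - b one gets 1 - (1 + b) e^(-b) \<le> b^2. The bound is quadratic in
  the mass, so that over N cells of mass c/N the probabilities add up to at most c^2/N.\<close>

lemma prob_ecount_ge_2:
  assumes A: "A \<in> sets borel" and "emeasure \<mu> A \<le> ennreal c" "c \<ge> 0"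
  shows "prob {\<omega>\<in>space M. ecount (\<Xi> \<omega> \<inter> A) \<ge> 2} \<le> c\<^sup>2"
proof -
  obtain b where b: "b \<ge> 0" "emeasure \<mu> A = ennreal b"
    using assms(2) by (cases "emeasure \<mu> A" rule: ennreal_cases) (auto simp: top_unique)
  have bc: "b \<le> c" using assms b by simp
  let ?E = "\<lambda>k. {\<omega>\<in>space M. ecount (\<Xi> \<omega> \<inter> A) = enat k}"
  have E: "?E k \<in> events" for k by (rule sets_ecount[OF A])
  have lt2: "n < 2 \<longleftrightarrow> n = enat 0 \<or> n = enat 1" for n :: enat
    by (cases n) (auto simp: numeral_eq_enat)
  have "{\<omega>\<in>space M. ecount (\<Xi> \<omega> \<inter> A) \<ge> 2} = space M - (?E 0 \<union> ?E 1)"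
    using lt2 by (auto simp: not_less[symmetric])
  then have "prob {\<omega>\<in>space M. ecount (\<Xi> \<omega> \<inter> A) \<ge> 2} = 1 - prob (?E 0 \<union> ?E 1)"
    using E by (simp add: prob_compl)
  also have "prob (?E 0 \<union> ?E 1) = prob (?E 0) + prob (?E 1)"
    using E by (intro finite_measure_Union) auto
  also have "\<dots> = (1 + b) * exp (- b)"
    unfolding prob_ecount[OF A b(2,1)] by (simp add: algebra_simps)
  also have "1 - (1 + b) * exp (- b) \<le> b\<^sup>2"
  proof -
    have "(1 + b) * (1 - b) \<le> (1 + b) * exp (- b)"
      using b exp_ge_add_one_self[of "- b"] by (intro mult_left_mono) auto
    then show ?thesis by (simp add: algebra_simps power2_eq_square)
  qed
  also have "b\<^sup>2 \<le> c\<^sup>2" using bc b by (simp add: power_mono)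
  finally show ?thesis .
qed

text \<open>Within each index j the parameter t will be a threshold. Any choice of one threshold per
  index yields disjoint sets, so independence of these families is the independence of finitely many
  counts, read at the value 0.\<close>

lemma indep_sets_empty:
  fixes A :: "nat \<Rightarrow> real \<Rightarrow> (real \<times> real) set"
  assumes A: "\<And>j t. A j t \<in> sets borel"
    and disj: "\<And>i j s t. i \<noteq> j \<Longrightarrow> A i s \<inter> A j t = {}"
  shows "indep_sets (\<lambda>j. range (\<lambda>t. {\<omega>\<in>space M. \<Xi> \<omega> \<inter> A j t = {}})) {..n}"
proof (rule indep_setsI)
  show "range (\<lambda>t. {\<omega>\<in>space M. \<Xi> \<omega> \<inter> A j t = {}}) \<subseteq> events" for j
    using sets_empty[OF A] by auto
next
  fix E and J :: "nat set"
  assume J: "J \<noteq> {}" "J \<subseteq> {..n}" "finite J"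
    and "\<forall>j\<in>J. E j \<in> range (\<lambda>t. {\<omega>\<in>space M. \<Xi> \<omega> \<inter> A j t = {}})"
  then have "\<forall>j\<in>J. \<exists>t. E j = {\<omega>\<in>space M. \<Xi> \<omega> \<inter> A j t = {}}" by blast
  then obtain t where t: "\<And>j. j \<in> J \<Longrightarrow> E j = {\<omega>\<in>space M. \<Xi> \<omega> \<inter> A j (t j) = {}}"
    by metis
  \<comment> \<open>The chosen t may be arbitrary outside J, because disjointness holds for all
    parameters; all n + 1 indices are used and the product is then taken over J alone.\<close>
  have "indep_vars (\<lambda>_. count_space UNIV) (\<lambda>i \<omega>. ecount (\<Xi> \<omega> \<inter> A i (t i))) {..<Suc n}"
  proof -
    have "\<forall>(n::nat) A. (\<forall>i<n. A i \<in> sets borel) \<longrightarrow> disjoint_family_on A {..<n} \<longrightarrow>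
       indep_vars (\<lambda>_. count_space UNIV) (\<lambda>i \<omega>. ecount (\<Xi> \<omega> \<inter> A i)) {..<n}"
      using pp unfolding poisson_process_def by (elim conjE)
    from this[rule_format, of "Suc n" "\<lambda>j. A j (t j)"] show ?thesis
      using disj A by (auto simp: disjoint_family_on_def)
  qed
  then have "prob (\<Inter>j\<in>J. (\<lambda>\<omega>. ecount (\<Xi> \<omega> \<inter> A j (t j))) -` {0} \<inter> space M)
      = (\<Prod>j\<in>J. prob ((\<lambda>\<omega>. ecount (\<Xi> \<omega> \<inter> A j (t j))) -` {0} \<inter> space M))"
    using J by (intro indep_varsD[where I="{..<Suc n}" and M'="\<lambda>_. count_space UNIV"]) auto
  moreover have "E j = (\<lambda>\<omega>. ecount (\<Xi> \<omega> \<inter> A j (t j))) -` {0} \<inter> space M" if "j \<in> J" for j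
    unfolding t[OF that] by auto
  ultimately show "prob (\<Inter>j\<in>J. E j) = (\<Prod>j\<in>J. prob (E j))" by simp
qed

end

text \<open>This turns the level events of an infimum into void events, the form in which a Poisson
  process is accessible. Nonemptiness is assumed because \<open>Inf {}\<close> has no specified
  value.\<close>

lemma le_Inf_image_iff:
  fixes f :: "'b \<Rightarrow> real"
  assumes "S \<inter> H \<noteq> {}" "\<And>z. b \<le> f z"
  shows "t \<le> Inf (f ` (S \<inter> H)) \<longleftrightarrow> S \<inter> (H \<inter> {z. f z < t}) = {}"
proof -
  have "bdd_below (f ` (S \<inter> H))" using assms by (intro bdd_belowI[of _ b]) auto
  then show ?thesis using assms(1) by (subst le_cInf_iff) (force simp: not_less)+
qed

text \<open>Void events below a threshold are closed under intersection, hence independent families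
  of them generate independent sigma-algebras, and each infimum is measurable with respect to its
  own.\<close>

lemma (in poisson_points) indep_vars_Inf:
  fixes f :: "real \<times> real \<Rightarrow> real" and H :: "nat \<Rightarrow> (real \<times> real) set"
  assumes f: "f \<in> borel_measurable borel" and b: "\<And>z. b \<le> f z"
    and H: "\<And>j. H j \<in> sets borel" and disj: "\<And>i j. i \<noteq> j \<Longrightarrow> H i \<inter> H j = {}"
  shows "indep_vars (\<lambda>_. borel) (\<lambda>j \<omega>. Inf (f ` (\<Xi> \<omega> \<inter> H j))) {..n}"
proof -
  let ?W = "\<lambda>j \<omega>. Inf (f ` (\<Xi> \<omega> \<inter> H j))"
  define E where "E j t = {\<omega>\<in>space M. \<Xi> \<omega> \<inter> (H j \<inter> {z. f z < t}) = {}}" for j t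
  have lt: "{z. f z < t} \<in> sets borel" for t
    using f by (simp add: borel_measurable_iff_less)
  have A: "H j \<inter> {z. f z < t} \<in> sets borel" for j t using H lt by (rule sets.Int)
  have E: "E j t \<in> events" for j t unfolding E_def by (rule sets_empty[OF A])
  have "indep_sets (\<lambda>j. range (E j)) {..n}"
    unfolding E_def using disj by (intro indep_sets_empty A) blast
  moreover have "Int_stable (range (E j))" for j
  proof (rule Int_stableI_image)
    fix s t
    \<comment> \<open>The larger threshold excludes more points, so its void event is the smaller
      one.\<close>
    have "E j s \<inter> E j t = E j (max s t)" by (fastforce simp: E_def)
    then show "\<exists>r\<in>UNIV. E j s \<inter> E j t = E j r" by blast
  qed
  ultimately have ind: "indep_sets (\<lambda>j. sigma_sets (space M) (range (E j))) {..n}"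
    by (intro indep_sets_sigma)
  have Pow: "range (E j) \<subseteq> Pow (space M)" for j by (auto simp: E_def)
  have sets_S: "sets (sigma (space M) (range (E j))) = sigma_sets (space M) (range (E j))" for j
    by (rule sets_measure_of[OF Pow])
  have space_S: "space (sigma (space M) (range (E j))) = space M" for j
    by (rule space_measure_of[OF Pow])
  have W_E: "?W j \<in> borel_measurable (sigma (space M) (range (E j)))" for j
    unfolding borel_measurable_iff_ge
  proof
    fix t
    let ?S = "sigma (space M) (range (E j))"
    have ES: "E j s \<in> sets ?S" for s unfolding sets_S by (rule sigma_sets.Basic) (rule rangeI)
    \<comment> \<open>Measurability is a statement about every \<open>\<omega>\<close>, so the empty
      case, where the infimum is the unspecified constant \<open>Inf {}\<close>, has to lie in the
      generated sigma-algebra too. It does: each value of f is below some natural number, so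
      emptiness is the intersection of the void events at natural thresholds.\<close>
    define Z where "Z = {\<omega>\<in>space M. \<Xi> \<omega> \<inter> H j = {}}"
    have "Z = (\<Inter>n. E j (real n))"
    proof
      show "(\<Inter>n. E j (real n)) \<subseteq> Z"
      proof
        fix \<omega> assume \<omega>: "\<omega> \<in> (\<Inter>n. E j (real n))"
        have "z \<notin> \<Xi> \<omega> \<inter> H j" for z
        proof
          assume "z \<in> \<Xi> \<omega> \<inter> H j"
          moreover obtain n where "f z < real n" using reals_Archimedean2 by blast
          ultimately show False using \<omega> by (auto simp: E_def)
        qed
        then show "\<omega> \<in> Z" using \<omega> by (auto simp: Z_def E_def)
      qed
    qed (auto simp: Z_def E_def)
    moreover have "(\<Inter>n. E j (real n)) \<in> sets ?S"
      using ES by (intro sets.countable_INT') (blast | simp)+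
    ultimately have Z: "Z \<in> sets ?S" by (simp only:)
    have "{\<omega>\<in>space M. t \<le> ?W j \<omega>} = (E j t - Z) \<union> (if t \<le> Inf {} then Z else {})"
    proof (intro set_eqI)
      fix \<omega>
      show "\<omega> \<in> {\<omega>\<in>space M. t \<le> ?W j \<omega>} \<longleftrightarrow> \<omega> \<in> (E j t - Z) \<union> (if t \<le> Inf {} then Z else {})"
        using le_Inf_image_iff[of "\<Xi> \<omega>" "H j" b f t] b by (cases "\<Xi> \<omega> \<inter> H j = {}") (auto simp: E_def Z_def)
    qed
    moreover have "(E j t - Z) \<union> (if t \<le> Inf {} then Z else {}) \<in> sets ?S"
    proof (intro sets.Un sets.Diff ES Z)
      show "(if t \<le> Inf {} then Z else {}) \<in> sets ?S"
        by (cases "t \<le> Inf {}") (simp_all only: if_True if_False Z sets.empty_sets)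
    qed
    ultimately show "{\<omega>\<in>space ?S. t \<le> ?W j \<omega>} \<in> sets ?S"
      by (simp only: space_S)
  qed
  show ?thesis
    unfolding indep_vars_def2
  proof
    show "indep_sets (\<lambda>j. {?W j -` A \<inter> space M |A. A \<in> sets borel}) {..n}"
      using ind
    proof (rule indep_sets_mono_sets)
      fix j
      show "{?W j -` A \<inter> space M |A. A \<in> sets borel} \<subseteq> sigma_sets (space M) (range (E j))"
        using measurable_sets[OF W_E[of j]] unfolding sets_S space_S by blast
    qed
    show "\<forall>j\<in>{..n}. ?W j \<in> borel_measurable M"
    proof
      fix j
      have "sigma_sets (space M) (range (E j)) \<subseteq> events"
        using E by (intro sets.sigma_sets_subset) blast
      then show "?W j \<in> borel_measurable M"
        using W_E[of j] unfolding borel_measurable_iff_ge sets_S space_S by blast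
    qed
  qed
qed

text \<open>Infinite mass makes H almost surely nonempty, so the level event of the infimum agrees
  almost surely with the void event below t.\<close>

lemma (in poisson_points) prob_le_Inf:
  fixes f :: "real \<times> real \<Rightarrow> real"
  assumes f: "f \<in> borel_measurable borel" and b: "\<And>z. b \<le> f z"
    and H: "H \<in> sets borel" "emeasure \<mu> H = \<infinity>"
    and c: "emeasure \<mu> (H \<inter> {z. f z < t}) = ennreal c" "c \<ge> 0"
  shows "prob {\<omega>\<in>space M. t \<le> Inf (f ` (\<Xi> \<omega> \<inter> H))} = exp (- c)"
proof -
  have "{z. f z < t} \<in> sets borel"
    using f by (simp add: borel_measurable_iff_less)
  with H have A: "H \<inter> {z. f z < t} \<in> sets borel" by (intro sets.Int)
  \<comment> \<open>Measurability of a single infimum is read off from the independence lemma; empty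
    sets at the other indices keep the family disjoint.\<close>
  have "indep_vars (\<lambda>_. borel) (\<lambda>j \<omega>. Inf (f ` (\<Xi> \<omega> \<inter> (if j = 0 then H else {})))) {..0::nat}"
    using H(1) by (intro indep_vars_Inf[OF f b]) simp_all
  then have "(\<lambda>\<omega>. Inf (f ` (\<Xi> \<omega> \<inter> (if (0::nat) = 0 then H else {})))) \<in> borel_measurable M"
    unfolding indep_vars_def2 by blast
  then have "{\<omega>\<in>space M. t \<le> Inf (f ` (\<Xi> \<omega> \<inter> H))} \<in> events"
    unfolding borel_measurable_iff_ge by (simp only: simp_thms if_True)
  moreover have "AE \<omega> in M. infinite (\<Xi> \<omega> \<inter> H)" by (rule AE_infinite[OF H])
  then have "AE \<omega> in M. \<omega> \<in> {\<omega>\<in>space M. t \<le> Inf (f ` (\<Xi> \<omega> \<inter> H))}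
      \<longleftrightarrow> \<omega> \<in> {\<omega>\<in>space M. \<Xi> \<omega> \<inter> (H \<inter> {z. f z < t}) = {}}"
  proof eventually_elim
    case (elim \<omega>)
    then have "\<Xi> \<omega> \<inter> H \<noteq> {}" by auto
    from le_Inf_image_iff[OF this b, of t] show ?case by auto
  qed
  ultimately have "prob {\<omega>\<in>space M. t \<le> Inf (f ` (\<Xi> \<omega> \<inter> H))}
      = prob {\<omega>\<in>space M. \<Xi> \<omega> \<inter> (H \<inter> {z. f z < t}) = {}}"
    using sets_empty[OF A] by (intro finite_measure_eq_AE)
  then show ?thesis using prob_empty[OF A c] by simp
qed

section \<open>Height cells\<close>

text \<open>For z not to the right of the line this is the \<open>exp_measure\<close> of the
  interval from z to the line. It is bounded below, so infima over nonempty sets are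
  genuine.\<close>

definition gap :: "real \<Rightarrow> real \<times> real \<Rightarrow> real" where
  "gap g z = exp (- fst z) - exp (- (g / 2))"

definition right_part :: "real \<Rightarrow> real \<Rightarrow> (real \<times> real) set" where
  "right_part g h = {g/2<..} \<times> {h..}"

definition level :: "real \<Rightarrow> real \<Rightarrow> nat \<Rightarrow> real" where
  "level g d j = g / 2 - real j * d"

text \<open>
  The function \<open>gap\<close> is negative exactly to the right of the line.  Joining the right-hand part
  above height \<open>h\<close> to strip 0 therefore makes the sign of the infimum over strip 0 tell whether
  that part contains a point.
\<close>

definition strip :: "real \<Rightarrow> real \<Rightarrow> real \<Rightarrow> nat \<Rightarrow> (real \<times> real) set" where
  "strip g d h j = (case j of 0 \<Rightarrow> {..g/2} \<times> {g/2..} \<union> right_part g h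
     | Suc i \<Rightarrow> {..g/2} \<times> {level g d (Suc i)..<level g d i})"

lemma strip_0: "strip g d h 0 = {..g/2} \<times> {g/2..} \<union> right_part g h"
  and strip_Suc: "strip g d h (Suc i) = {..g/2} \<times> {level g d (Suc i)..<level g d i}"
  by (simp_all add: strip_def)

lemma level_0 [simp]: "level g d 0 = g / 2"
  by (simp add: level_def)

lemma level_mono: "d > 0 \<Longrightarrow> i \<le> j \<Longrightarrow> level g d j \<le> level g d i"
  by (simp add: level_def)

lemma level_less: "d > 0 \<Longrightarrow> i < j \<Longrightarrow> level g d j < level g d i"
  by (simp add: level_def)

text \<open>The total rates form a geometric sequence in j; this is the hypothesis of
  \<open>prob_records\<close> with 1 - p = e^(-d) and the reason why all cells have the same record
  probability.\<close>

lemma exp_level: "exp (- level g d j) = exp (- d) * exp (- level g d (Suc j))"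
  by (simp add: level_def exp_add[symmetric] algebra_simps)

lemma right_part_borel: "right_part g h \<in> sets borel"
  unfolding right_part_def by (intro borel_Times2) simp_all

lemma strip_borel: "strip g d h j \<in> sets borel"
  by (cases j) (auto simp only: strip_0 strip_Suc right_part_borel intro!: borel_Times2 sets.Un atMost_borel atLeast_borel atLeastLessThan_borel)

lemma disjoint_strip:
  assumes d: "d > 0" and "i \<noteq> j"
  shows "strip g d h i \<inter> strip g d h j = {}"
proof -
  have "strip g d h i \<inter> strip g d h j = {}" if ij: "i < j" for i j
  proof -
    obtain m where m: "j = Suc m" "i \<le> m" using ij by (cases j) auto
    have "level g d m \<le> level g d i" "level g d m \<le> g / 2"
      using level_mono[OF d m(2)] level_mono[OF d, of 0 m] by auto
    then show ?thesis
      unfolding m strip_Suc by (cases i) (auto simp: strip_0 strip_Suc right_part_def)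
  qed
  from this[of i j] this[of j i] assms(2) show ?thesis by (cases "i < j") (auto simp: Int_commute)
qed

lemma gap_borel: "gap g \<in> borel_measurable borel"
  unfolding gap_def by (intro borel_measurable_continuous_onI continuous_intros)

lemma gap_ge: "- exp (- (g / 2)) \<le> gap g z"
  by (simp add: gap_def)

lemma gap_le_iff: "gap g y \<le> gap g z \<longleftrightarrow> fst z \<le> fst y"
  by (simp add: gap_def)

lemma gap_less_iff:
  assumes "t \<ge> 0" shows "gap g z < t \<longleftrightarrow> - ln (exp (- (g / 2)) + t) < fst z"
proof -
  have pos: "exp (- (g / 2)) + t > 0" using assms by (simp add: add_pos_nonneg)
  have "gap g z < t \<longleftrightarrow> exp (- fst z) < exp (ln (exp (- (g / 2)) + t))"
    using pos by (simp add: gap_def algebra_simps)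
  also have "\<dots> \<longleftrightarrow> - ln (exp (- (g / 2)) + t) < fst z" by (simp only: exp_less_cancel_iff) linarith
  finally show ?thesis .
qed

text \<open>In the coordinate \<open>gap\<close> the part left of the line has constant density 1,
  which makes the void probabilities of the strips exponential in t.\<close>

lemma exp_measure_gap:
  assumes "t \<ge> 0"
  shows "emeasure exp_measure {- ln (exp (- (g / 2)) + t)<..g / 2} = ennreal t"
proof -
  have pos: "exp (- (g / 2)) + t > 0" using assms by (simp add: add_pos_nonneg)
  have "ln (exp (- (g / 2))) \<le> ln (exp (- (g / 2)) + t)" using assms pos by (subst ln_le_cancel_iff) auto
  then have "- ln (exp (- (g / 2)) + t) \<le> g / 2" by simp
  from exp_measure_greaterThanAtMost[OF this] show ?thesis using pos by simp
qed

lemma emeasure_right_part: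
  assumes "h \<le> g / 2"
  shows "emeasure (intensity g) (right_part g h) = ennreal (exp (- (g / 2)) * (exp (- h) - exp (- (g / 2))))"
proof -
  have "right_part g h - {z. diag_pt g \<prec> z} = {g/2<..} \<times> {h..g/2}"
    by (auto simp: right_part_def diag_pt_def dominated_def)
  from emeasure_intensity_Times[OF _ _ right_part_borel this] show ?thesis
    using assms by (simp add: exp_measure_greaterThan exp_measure_atLeastAtMost ennreal_mult)
qed

lemma emeasure_left:
  assumes "A \<subseteq> {..g/2}" "A \<in> sets borel" "B \<in> sets borel"
  shows "emeasure (intensity g) (A \<times> B) = emeasure exp_measure A * emeasure exp_measure B"
proof -
  have "A \<times> B - {z. diag_pt g \<prec> z} = A \<times> B"
    using assms(1) by (auto simp: diag_pt_def dominated_def)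
  from emeasure_intensity_Times[OF assms(2,3) borel_Times2[OF assms(2,3)] this] show ?thesis .
qed

text \<open>Every strip is unbounded to the left, where e^(-x) has infinite mass; so almost surely
  no strip is empty.\<close>

lemma emeasure_strip:
  assumes "d > 0"
  shows "emeasure (intensity g) (strip g d h j) = \<infinity>"
proof (cases j)
  case 0
  have "emeasure (intensity g) ({..g/2} \<times> {g/2..}) = \<infinity>"
    by (subst emeasure_left) (auto simp: exp_measure_atMost exp_measure_atLeast ennreal_top_mult)
  moreover have "emeasure (intensity g) ({..g/2} \<times> {g/2..}) \<le> emeasure (intensity g) (strip g d h j)"
    using strip_borel[of g d h j] by (intro emeasure_mono) (auto simp: 0 strip_0)
  ultimately show ?thesis by (simp add: top_unique)
next
  case (Suc i)
  have "level g d (Suc i) < level g d i" using level_less[OF assms] by simp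
  then show ?thesis
    unfolding Suc strip_Suc
    by (subst emeasure_left) (auto simp: exp_measure_atMost exp_measure_atLeastLessThan ennreal_top_mult)
qed

text \<open>For t \<ge> 0 all of the right-hand part lies below the threshold. It adds a constant to
  the mass, which becomes the factor \<open>right_void_prob g h\<close> in front of an exponential
  tail of rate e^(-g/2).\<close>

lemma emeasure_strip_gap_0:
  assumes "h \<le> g / 2" "t \<ge> 0"
  shows "emeasure (intensity g) (strip g d h 0 \<inter> {z. gap g z < t})
    = ennreal (exp (- (g / 2)) * (exp (- h) - exp (- (g / 2))) + exp (- (g / 2)) * t)"
proof -
  let ?L = "{- ln (exp (- (g / 2)) + t)<..g / 2} \<times> {g/2..}"
  have neg: "gap g z < t" if "fst z > g / 2" for z
    using that assms(2) by (auto simp: gap_def intro: less_le_trans[of _ 0])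
  have "strip g d h 0 \<inter> {z. gap g z < t} = right_part g h \<union> ?L"
    using neg by (auto simp: strip_0 right_part_def gap_less_iff[OF assms(2)])
  moreover have "right_part g h \<inter> ?L = {}" by (auto simp: right_part_def)
  moreover have "?L \<in> sets borel" by (intro borel_Times2) simp_all
  ultimately have "emeasure (intensity g) (strip g d h 0 \<inter> {z. gap g z < t})
      = emeasure (intensity g) (right_part g h) + emeasure (intensity g) ?L"
    using right_part_borel by (simp add: plus_emeasure)
  also have "emeasure (intensity g) ?L = ennreal (exp (- (g / 2)) * t)"
    using assms(2) by (subst emeasure_left) (auto simp: exp_measure_gap exp_measure_atLeast ennreal_mult' mult.commute)
  finally show ?thesis using assms by (simp add: emeasure_right_part ennreal_plus)
qed

lemma emeasure_strip_gap_Suc: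
  assumes "d > 0" "t \<ge> 0"
  shows "emeasure (intensity g) (strip g d h (Suc j) \<inter> {z. gap g z < t})
    = ennreal ((exp (- level g d (Suc j)) - exp (- level g d j)) * t)"
proof -
  have "level g d (Suc j) < level g d j" using level_less[OF assms(1)] by simp
  moreover have "strip g d h (Suc j) \<inter> {z. gap g z < t}
      = {- ln (exp (- (g / 2)) + t)<..g / 2} \<times> {level g d (Suc j)..<level g d j}"
    by (auto simp: strip_Suc gap_less_iff[OF assms(2)])
  ultimately show ?thesis
    using assms by (simp only:, subst emeasure_left)
      (auto simp: exp_measure_gap exp_measure_atLeastLessThan ennreal_mult' mult.commute)
qed

text \<open>The ceiling fits cells that are closed at their lower end; heights from g/2 upwards are
  sent to 0 by \<open>nat\<close>.\<close>

definition cell_index :: "real \<Rightarrow> real \<Rightarrow> real \<times> real \<Rightarrow> nat" where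
  "cell_index g d y = nat \<lceil>(g / 2 - snd y) / d\<rceil>"

definition dominated_maxima :: "real \<Rightarrow> (real \<times> real) set \<Rightarrow> (real \<times> real) set" where
  "dominated_maxima g S = {y \<in> maxima S. y \<prec> diag_pt g}"

text \<open>The infimum has an unspecified value on an empty strip, which happens with probability 0.\<close>

definition strip_depth :: "real \<Rightarrow> real \<Rightarrow> real \<Rightarrow> (real \<times> real) set \<Rightarrow> nat \<Rightarrow> real" where
  "strip_depth g d h S j = Inf (gap g ` (S \<inter> strip g d h j))"

lemma cell_index_eq_Suc_iff:
  assumes "d > 0"
  shows "cell_index g d y = Suc j \<longleftrightarrow> level g d (Suc j) \<le> snd y \<and> snd y < level g d j"
proof -
  have "cell_index g d y = Suc j \<longleftrightarrow> \<lceil>(g / 2 - snd y) / d\<rceil> = int (Suc j)"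
    unfolding cell_index_def by linarith
  also have "\<dots> \<longleftrightarrow> real j < (g / 2 - snd y) / d \<and> (g / 2 - snd y) / d \<le> real (Suc j)"
    by (simp add: ceiling_eq_iff)
  also have "\<dots> \<longleftrightarrow> level g d (Suc j) \<le> snd y \<and> snd y < level g d j"
    using assms by (auto simp: level_def field_simps)
  finally show ?thesis .
qed

lemma cell_index_pos: "d > 0 \<Longrightarrow> snd y < g / 2 \<Longrightarrow> cell_index g d y \<ge> 1"
proof -
  assume "d > 0" "snd y < g / 2"
  then have "0 < \<lceil>(g / 2 - snd y) / d\<rceil>" by simp
  then show ?thesis unfolding cell_index_def by linarith
qed

text \<open>If a cell holds a record, its rightmost point is maximal: a dominating point cannot lie
  right of the line, where everything above h is void, and cannot lie in an earlier strip, all of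
  whose points are at most as far to the right. Conversely, points of earlier strips lie above a
  dominated maximum and hence not further to the right. Cells are compared, not points, so several
  maxima in one cell count once.\<close>

lemma records_strip_depth:
  assumes d: "d > 0" and h: "h \<le> level g d i"
    and fin: "\<And>B. bounded B \<Longrightarrow> finite (S \<inter> B)"
    and ne: "\<And>j. j \<le> i \<Longrightarrow> S \<inter> strip g d h j \<noteq> {}"
    and line: "\<And>z. z \<in> S \<Longrightarrow> fst z \<noteq> g / 2"
    and right: "S \<inter> right_part g h = {}"
  shows "records (strip_depth g d h S) i = cell_index g d ` dominated_maxima g S \<inter> {1..i}"
proof
  have bdd: "bdd_below (gap g ` A)" for A
    using gap_ge by (intro bdd_belowI[of _ "- exp (- (g / 2))"]) auto
  have depth_le: "strip_depth g d h S j \<le> gap g z" if "z \<in> S" "z \<in> strip g d h j" for j z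
    unfolding strip_depth_def using that bdd by (intro cInf_lower) auto
  have in_strip: "z \<in> strip g d h (cell_index g d z)" if z: "fst z \<le> g / 2" "snd z < g / 2" for z
  proof -
    obtain l where l: "cell_index g d z = Suc l"
      using cell_index_pos[OF d z(2)] by (cases "cell_index g d z") auto
    then show ?thesis
      using cell_index_eq_Suc_iff[OF d, of g z l] z by (cases z) (auto simp: strip_Suc)
  qed
  show "records (strip_depth g d h S) i \<subseteq> cell_index g d ` dominated_maxima g S \<inter> {1..i}"
  proof
    fix j assume j: "j \<in> records (strip_depth g d h S) i"
    then obtain m where m: "j = Suc m" "m < i" by (cases j) (auto simp: records_def)
    have rec: "strip_depth g d h S j \<le> strip_depth g d h S l" if "l < j" for l
      using j that by (simp add: records_def)
    obtain z0 where z0: "z0 \<in> S" "z0 \<in> strip g d h j" using ne[of j] m by auto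
    \<comment> \<open>The infimum is attained although the strip is unbounded: the points at least
      as far right as z0 lie in a bounded rectangle and are finitely many.\<close>
    define B where "B = S \<inter> strip g d h j \<inter> {z. fst z0 \<le> fst z}"
    have "B \<subseteq> S \<inter> ({fst z0..g/2} \<times> {level g d j..level g d m})"
      by (auto simp: B_def m strip_Suc)
    then have "finite B" by (rule finite_subset) (intro fin bounded_Times, simp_all)
    moreover have z0B: "z0 \<in> B" using z0 by (auto simp: B_def)
    ultimately obtain y where y: "y \<in> B" "\<And>z. z \<in> B \<Longrightarrow> gap g y \<le> gap g z"
      using arg_min_if_finite(1)[of B "gap g"] arg_min_least[of B _ "gap g"] by (metis empty_iff)
    have y_min: "gap g y \<le> gap g z" if "z \<in> S" "z \<in> strip g d h j" for z
    proof (cases "fst z0 \<le> fst z")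
      case True
      then have "z \<in> B" using that by (simp add: B_def)
      then show ?thesis by (rule y)
    next
      case False
      then have "gap g z0 \<le> gap g z" by (simp add: gap_le_iff)
      with y(2)[OF z0B] show ?thesis by simp
    qed
    have depth_y: "strip_depth g d h S j = gap g y"
      unfolding strip_depth_def using y(1) y_min by (intro cInf_eq_minimum) (auto simp: B_def)
    \<comment> \<open>The strips contain the line itself; only its being free of points makes the
      inequality strict, as domination by x(g) requires.\<close>
    have yS: "y \<in> S" "fst y < g / 2" "level g d j \<le> snd y" "snd y < level g d m"
      using y(1) line[of y] by (auto simp: B_def m strip_Suc)
    moreover have "level g d m \<le> g / 2" using level_mono[OF d, of 0 m] by simp
    ultimately have "y \<prec> diag_pt g" by (simp add: diag_pt_def dominated_def)
    moreover have cell_y: "cell_index g d y = j"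
      using yS unfolding m by (simp add: cell_index_eq_Suc_iff[OF d])
    moreover have "\<not> y \<prec> z" if z: "z \<in> S" for z
    proof
      assume yz: "y \<prec> z"
      \<comment> \<open>To the right of the line z would lie above h, since y is at height at least
        \<open>level g d j\<close> and j \<le> i; the void condition forbids this.\<close>
      have fst_z: "fst z \<le> g / 2"
      proof (rule ccontr)
        assume "\<not> fst z \<le> g / 2"
        moreover have "h \<le> snd z"
          using h level_mono[OF d, of j i g] yS yz m by (auto simp: dominated_def)
        ultimately have "z \<in> right_part g h" by (cases z) (auto simp: right_part_def)
        then show False using right z by auto
      qed
      have "\<exists>l\<le>j. z \<in> strip g d h l"
      proof (cases "snd z < g / 2")
        case True
        have "(g / 2 - snd z) / d \<le> (g / 2 - snd y) / d"
          using yz d by (intro divide_right_mono) (auto simp: dominated_def)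
        then have "cell_index g d z \<le> j"
          unfolding cell_y[symmetric] cell_index_def by (intro nat_mono ceiling_mono)
        then show ?thesis using in_strip[OF fst_z True] by auto
      next
        case False
        then have "z \<in> strip g d h 0" using fst_z by (cases z) (auto simp: strip_0)
        then show ?thesis by auto
      qed
      then obtain l where l: "l \<le> j" "z \<in> strip g d h l" by auto
      have "gap g y \<le> gap g z"
      proof (cases "l = j")
        case True
        then show ?thesis using y_min z l by simp
      next
        case False
        then have "gap g y \<le> strip_depth g d h S l" using rec[of l] l depth_y by simp
        also have "\<dots> \<le> gap g z" using z l by (intro depth_le)
        finally show ?thesis .
      qed
      then show False using yz by (simp add: gap_le_iff dominated_def)
    qed
    ultimately have "y \<in> dominated_maxima g S"
      using yS by (simp add: dominated_maxima_def maxima_def)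
    then show "j \<in> cell_index g d ` dominated_maxima g S \<inter> {1..i}"
      using cell_y m image_eqI[of j "cell_index g d" y] by auto
  qed
  show "cell_index g d ` dominated_maxima g S \<inter> {1..i} \<subseteq> records (strip_depth g d h S) i"
  proof safe
    fix y assume j: "cell_index g d y \<in> {1..i}" and "y \<in> dominated_maxima g S"
    then have y: "y \<in> S" "\<And>z. z \<in> S \<Longrightarrow> \<not> y \<prec> z" "fst y < g / 2" "snd y < g / 2"
      by (auto simp: dominated_maxima_def maxima_def diag_pt_def dominated_def)
    have "strip_depth g d h S (cell_index g d y) \<le> strip_depth g d h S l" if l: "l < cell_index g d y" for l
    proof -
      obtain m where m: "cell_index g d y = Suc m" using l by (cases "cell_index g d y") auto
      have ym: "snd y < level g d m" using m cell_index_eq_Suc_iff[OF d] by simp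
      have "strip_depth g d h S (cell_index g d y) \<le> gap g y"
        using y in_strip[of y] by (intro depth_le) auto
      also have "gap g y \<le> strip_depth g d h S l"
        unfolding strip_depth_def
      proof (rule cInf_greatest)
        show "gap g ` (S \<inter> strip g d h l) \<noteq> {}" using ne[of l] l j by auto
        fix x assume "x \<in> gap g ` (S \<inter> strip g d h l)"
        then obtain z where z: "z \<in> S" "z \<in> strip g d h l" "x = gap g z" by auto
        \<comment> \<open>Strip 0 starts at height g/2 once its right-hand part is void; the other
          strips before the cell of y end no lower than that cell begins from above.\<close>
        have "snd y < snd z"
        proof (cases l)
          case 0
          then show ?thesis using z right y by (auto simp: strip_0)
        next
          case (Suc n)
          have "level g d m \<le> level g d l" using l m by (intro level_mono[OF d]) simp
          moreover have "level g d l \<le> snd z" using z by (auto simp: Suc strip_Suc)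
          ultimately show ?thesis using ym by simp
        qed
        then have "fst z \<le> fst y" using y(2)[OF z(1)] by (auto simp: dominated_def)
        then show "gap g y \<le> x" by (simp add: z gap_le_iff)
      qed
      finally show ?thesis .
    qed
    then show "cell_index g d y \<in> records (strip_depth g d h S) i"
      using j by (simp add: records_def)
  qed
qed

text \<open>The void probability of \<open>right_part g h\<close> for h \<le> g/2. At h = g/2 - t
  with t \<ge> 0 it is the conditional probability of g - G \<ge> t given g - G > 0.\<close>

definition right_void_prob :: "real \<Rightarrow> real \<Rightarrow> real" where
  "right_void_prob g h = exp (- (exp (- (g / 2)) * (exp (- h) - exp (- (g / 2)))))"

section \<open>Record counts for a fixed cell length\<close>

locale record_process =
  fixes M :: "'w measure" and g :: real and \<Xi> :: "'w \<Rightarrow> (real \<times> real) set"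
  assumes pp: "poisson_process M (intensity g) \<Xi>"
begin

sublocale poisson_points M "intensity g" \<Xi>
  by standard (rule pp)

lemma indep_vars_strip_depth:
  "d > 0 \<Longrightarrow> indep_vars (\<lambda>_. borel) (\<lambda>j \<omega>. strip_depth g d h (\<Xi> \<omega>) j) {..n}"
  unfolding strip_depth_def
  by (intro indep_vars_Inf[OF gap_borel gap_ge strip_borel] disjoint_strip)

lemma AE_strip_nonempty:
  assumes "d > 0" shows "AE \<omega> in M. \<forall>j. \<Xi> \<omega> \<inter> strip g d h j \<noteq> {}"
proof -
  have "AE \<omega> in M. infinite (\<Xi> \<omega> \<inter> strip g d h j)" for j
    by (intro AE_infinite strip_borel emeasure_strip assms)
  then have "AE \<omega> in M. \<forall>j. infinite (\<Xi> \<omega> \<inter> strip g d h j)"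
    by (subst AE_all_countable) blast
  then show ?thesis by eventually_elim (metis finite.emptyI)
qed

lemma AE_off_line: "AE \<omega> in M. \<forall>z\<in>\<Xi> \<omega>. fst z \<noteq> g / 2"
proof -
  have "emeasure (intensity g) ({g/2} \<times> UNIV) = 0"
    using exp_measure_atLeastAtMost[of "g / 2" "g / 2"] by (subst emeasure_left) auto
  then have "AE \<omega> in M. \<Xi> \<omega> \<inter> ({g/2} \<times> UNIV) = {}"
    by (intro AE_empty borel_Times2) simp_all
  then show ?thesis by eventually_elim auto
qed

text \<open>Strips from 1 on lie left of the line and have nonnegative depth anyway, so the
  condition only tests strip 0. This lets \<open>prob_records\<close> at t = 0 speak about the void
  event.\<close>

lemma strip_depth_nonneg_iff:
  assumes "\<forall>j. S \<inter> strip g d h j \<noteq> {}"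
  shows "(\<forall>j\<le>i. 0 \<le> strip_depth g d h S j) \<longleftrightarrow> S \<inter> right_part g h = {}"
proof -
  have iff: "0 \<le> strip_depth g d h S j \<longleftrightarrow> S \<inter> (strip g d h j \<inter> {z. gap g z < 0}) = {}" for j
    unfolding strip_depth_def using assms gap_ge by (intro le_Inf_image_iff) auto
  have gap_neg: "gap g z < 0 \<longleftrightarrow> g / 2 < fst z" for z
    by (simp add: gap_def)
  have "strip g d h 0 \<inter> {z. gap g z < 0} = right_part g h"
    by (auto simp: gap_neg strip_0 right_part_def)
  moreover have "strip g d h (Suc j) \<inter> {z. gap g z < 0} = {}" for j
    by (auto simp: gap_neg strip_Suc)
  ultimately have "0 \<le> strip_depth g d h S j \<longleftrightarrow> j \<noteq> 0 \<or> S \<inter> right_part g h = {}" for j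
    unfolding iff by (cases j) auto
  then show ?thesis by auto
qed

lemma sets_card_records:
  assumes "d > 0"
  shows "{\<omega>\<in>space M. card (records (strip_depth g d h (\<Xi> \<omega>)) i) = k} \<in> events"
proof -
  have rv: "(\<lambda>\<omega>. strip_depth g d h (\<Xi> \<omega>) j) \<in> borel_measurable M" if "j \<in> {..i}" for j
    using indep_vars_strip_depth[OF assms, of h i] that unfolding indep_vars_def by blast
  have "(\<lambda>\<omega>. restrict (strip_depth g d h (\<Xi> \<omega>)) {..i}) \<in> measurable M (Pi\<^sub>M {..i} (\<lambda>_. borel))"
    by (intro measurable_restrict rv)
  from measurable_sets[OF this measurable_card_records[of i k]]
  have "(\<lambda>\<omega>. restrict (strip_depth g d h (\<Xi> \<omega>)) {..i}) -`
      {w\<in>space (Pi\<^sub>M {..i} (\<lambda>_. borel)). card (records w i) = k} \<inter> space M \<in> events" .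
  moreover have "(\<lambda>\<omega>. restrict (strip_depth g d h (\<Xi> \<omega>)) {..i}) -`
      {w\<in>space (Pi\<^sub>M {..i} (\<lambda>_. borel)). card (records w i) = k} \<inter> space M
    = {\<omega>\<in>space M. card (records (strip_depth g d h (\<Xi> \<omega>)) i) = k}"
    by (auto simp: records_restrict space_PiM)
  ultimately show ?thesis by simp
qed

definition void_records :: "real \<Rightarrow> real \<Rightarrow> nat \<Rightarrow> nat \<Rightarrow> 'w set" where
  "void_records d h i k = {\<omega>\<in>space M. \<Xi> \<omega> \<inter> right_part g h = {}
     \<and> card (records (strip_depth g d h (\<Xi> \<omega>)) i) = k}"

lemma sets_void_records: "d > 0 \<Longrightarrow> void_records d h i k \<in> events"
  unfolding void_records_def
  by (intro sets.sets_Collect_conj sets_empty right_part_borel sets_card_records)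

text \<open>This is \<open>prob_records\<close> at t = 0, with W j the depth of strip j and C j =
  \<open>exp (- level g d j)\<close>: strip j + 1 has rate C (j+1) - C j, and v, the probability
  that W 0 is nonnegative, is the void probability of the right-hand part.\<close>

lemma prob_void_records:
  assumes d: "d > 0" and h: "h \<le> g / 2"
  shows "prob (void_records d h i k) = right_void_prob g h * binom_prob (1 - exp (- d)) i k"
proof -
  let ?W = "\<lambda>j \<omega>. strip_depth g d h (\<Xi> \<omega>) j"
  let ?E = "{\<omega>\<in>space M. (\<forall>j\<le>i. 0 \<le> ?W j \<omega>) \<and> card (records (\<lambda>j. ?W j \<omega>) i) = k}"
  define C where "C j = exp (- level g d j)" for j
  have "{\<omega>\<in>space M. \<forall>j\<in>{..i}. 0 \<le> ?W j \<omega>} \<in> events"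
    using indep_vars_strip_depth[OF d, of h i] unfolding indep_vars_def
    by (intro sets.sets_Collect_finite_All borel_measurable_le borel_measurable_const) auto
  then have "{\<omega>\<in>space M. \<forall>j\<le>i. 0 \<le> ?W j \<omega>} \<in> events"
    by (simp only: Ball_def atMost_iff)
  then have "?E \<in> events"
    using sets_card_records[OF d] by (intro sets.sets_Collect_conj)
  moreover have "AE \<omega> in M. \<omega> \<in> void_records d h i k \<longleftrightarrow> \<omega> \<in> ?E"
    using AE_strip_nonempty[OF d, of h]
  proof eventually_elim
    case (elim \<omega>)
    then show ?case by (simp add: void_records_def strip_depth_nonneg_iff)
  qed
  ultimately have "prob (void_records d h i k) = prob ?E"
    using sets_void_records[OF d] by (intro finite_measure_eq_AE)
  also have "\<dots> = right_void_prob g h * exp (- C i * 0) * binom_prob (1 - exp (- d)) i k"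
  proof (rule prob_records[OF indep_vars_strip_depth[OF d, where n = i]])
    show "0 < 1 - exp (- d)" "1 - exp (- d) < 1" using d by simp_all
    show "0 < C 0" by (simp add: C_def)
    show "C j = (1 - (1 - exp (- d))) * C (Suc j)" for j
      using exp_level[of g d j] by (simp add: C_def)
    show "prob {\<omega>\<in>space M. t \<le> ?W 0 \<omega>} = right_void_prob g h * exp (- C 0 * t)" if "t \<ge> 0" for t
    proof -
      have "prob {\<omega>\<in>space M. t \<le> ?W 0 \<omega>}
          = exp (- (exp (- (g / 2)) * (exp (- h) - exp (- (g / 2))) + exp (- (g / 2)) * t))"
        unfolding strip_depth_def
        using h that
        by (intro prob_le_Inf[OF gap_borel gap_ge strip_borel emeasure_strip[OF d] emeasure_strip_gap_0]) simp_all
      then show ?thesis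
        by (simp add: right_void_prob_def C_def exp_add[symmetric])
    qed
    show "prob {\<omega>\<in>space M. t \<le> ?W (Suc j) \<omega>} = exp (- (C (Suc j) - C j) * t)" if "t \<ge> 0" for j t
    proof -
      have "C j \<le> C (Suc j)" using level_mono[OF d, of j "Suc j" g] by (simp add: C_def)
      then have "prob {\<omega>\<in>space M. t \<le> ?W (Suc j) \<omega>}
          = exp (- ((exp (- level g d (Suc j)) - exp (- level g d j)) * t))"
        unfolding strip_depth_def C_def
        using that
        by (intro prob_le_Inf[OF gap_borel gap_ge strip_borel emeasure_strip[OF d] emeasure_strip_gap_Suc[OF d]]) simp_all
      then show ?thesis by (simp add: C_def algebra_simps)
    qed
  qed simp_all
  finally show ?thesis by simp
qed

text \<open>The event that the highest right-hand point lies in cell i + 1 and that k of the cells 1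
  to i hold a record. Cell i + 1 is left out of the count, which makes no difference once the cells
  are fine enough.\<close>

definition cell_records :: "real \<Rightarrow> nat \<Rightarrow> nat \<Rightarrow> 'w set" where
  "cell_records d i k = void_records d (level g d i) i k
     - {\<omega>\<in>space M. \<Xi> \<omega> \<inter> right_part g (level g d (Suc i)) = {}}"

lemma sets_cell_records: "d > 0 \<Longrightarrow> cell_records d i k \<in> events"
  unfolding cell_records_def
  by (intro sets.Diff sets_empty right_part_borel sets_void_records)

text \<open>The two void events come with different sets for strip 0, hence with formally different
  depths. When both right-hand parts are void, either set of records is the set of cells of
  dominated maxima up to i, which does not mention h; so the probabilities may be
  subtracted.\<close>

lemma prob_cell_records:
  assumes d: "d > 0"
  shows "prob (cell_records d i k)
    = (right_void_prob g (level g d i) - right_void_prob g (level g d (Suc i))) * binom_prob (1 - exp (- d)) i k"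
proof -
  let ?A = "void_records d (level g d i) i k"
  let ?B = "{\<omega>\<in>space M. \<Xi> \<omega> \<inter> right_part g (level g d (Suc i)) = {}}"
  have le: "level g d (Suc i) \<le> level g d i" using level_mono[OF d] by simp
  have B: "?B \<in> events" by (intro sets_empty right_part_borel)
  have "AE \<omega> in M. \<omega> \<in> ?A \<inter> ?B \<longleftrightarrow> \<omega> \<in> void_records d (level g d (Suc i)) i k"
    using AE_strip_nonempty[OF d, of "level g d i"] AE_strip_nonempty[OF d, of "level g d (Suc i)"]
      AE_off_line AE_space
  proof eventually_elim
    case (elim \<omega>)
    have "right_part g (level g d i) \<subseteq> right_part g (level g d (Suc i))"
      using le by (auto simp: right_part_def)
    then have sub: "\<Xi> \<omega> \<inter> right_part g (level g d (Suc i)) = {} \<Longrightarrow> \<Xi> \<omega> \<inter> right_part g (level g d i) = {}"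
      by blast
    have rec: "records (strip_depth g d h (\<Xi> \<omega>)) i
        = cell_index g d ` dominated_maxima g (\<Xi> \<omega>) \<inter> {1..i}"
      if "h = level g d i \<or> h = level g d (Suc i)" "\<Xi> \<omega> \<inter> right_part g h = {}" for h
      using that elim le d by (intro records_strip_depth finite_points) auto
    show ?case
      using sub rec[of "level g d i"] rec[of "level g d (Suc i)"] by (auto simp: void_records_def)
  qed
  then have "prob (?A \<inter> ?B) = prob (void_records d (level g d (Suc i)) i k)"
    using B sets_void_records[OF d] by (intro finite_measure_eq_AE sets.Int)
  moreover have "prob (cell_records d i k) = prob ?A - prob (?A \<inter> ?B)"
    unfolding cell_records_def
    using B sets_void_records[OF d] by (intro finite_measure_Diff')
  moreover have "level g d i \<le> g / 2" "level g d (Suc i) \<le> g / 2"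
    using level_mono[OF d, of 0] by force+
  ultimately show ?thesis using d by (simp add: prob_void_records algebra_simps)
qed

lemma sums_prob_cell_records:
  assumes d: "d > 0"
  shows "(\<lambda>i. (right_void_prob g (level g d i) - right_void_prob g (level g d (Suc i))) * binom_prob (1 - exp (- d)) i k)
    sums prob (\<Union>i. cell_records d i k)"
  unfolding prob_cell_records[OF d, symmetric]
proof (rule finite_measure_UNION)
  show "range (\<lambda>i. cell_records d i k) \<subseteq> events" using sets_cell_records[OF d] by blast
  \<comment> \<open>For i < j the later event demands that the right-hand part above level j be
    void, and this contains the part that the earlier event demands to be occupied.\<close>
  have "cell_records d i k \<inter> cell_records d j k = {}" if "i < j" for i j
  proof -
    have "level g d j \<le> level g d (Suc i)" using that by (intro level_mono[OF d]) simp
    then have "right_part g (level g d (Suc i)) \<subseteq> right_part g (level g d j)" by (auto simp: right_part_def)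
    then show ?thesis by (auto simp: cell_records_def void_records_def)
  qed
  then show "disjoint_family (\<lambda>i. cell_records d i k)"
    by (auto simp: disjoint_family_on_def) (metis disjoint_iff linorder_neqE_nat)
qed

end

section \<open>Points at distinct heights\<close>

lemma exp_measure_atLeastLessThan_le:
  assumes "- m \<le> a" "a \<le> b"
  shows "emeasure exp_measure {a..<b} \<le> ennreal (exp m * (b - a))"
proof -
  have "exp (- a) - exp (- b) = exp (- a) * (1 - exp (a - b))"
    by (simp add: algebra_simps exp_add[symmetric])
  also have "\<dots> \<le> exp m * (b - a)"
  proof (rule mult_mono)
    show "1 - exp (a - b) \<le> b - a" using exp_ge_add_one_self[of "a - b"] by linarith
  qed (use assms in auto)
  finally show ?thesis
    unfolding exp_measure_atLeastLessThan[OF assms(2)] by (rule ennreal_leI)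
qed

lemma ecount_ge_2I:
  assumes "x \<in> A" "y \<in> A" "x \<noteq> y" shows "ecount A \<ge> 2"
proof (cases "finite A")
  case True
  have "card {x, y} \<le> card A" using True assms by (intro card_mono) auto
  then show ?thesis using True assms by (simp add: ecount_def numeral_eq_enat)
qed (simp add: ecount_def)

text \<open>Two points of equal height in a square share a slab in every subdivision into n + 1
  horizontal slabs. A slab has mass of order 1/(n+1), so some slab holds two points with probability
  at most c^2/(n+1), which tends to 0.\<close>

lemma (in poisson_points) AE_inj_on_snd:
  assumes "\<mu> = intensity g"
  shows "AE \<omega> in M. inj_on snd (\<Xi> \<omega>)"
proof -
  have "AE \<omega> in M. inj_on snd (\<Xi> \<omega> \<inter> {- real m..<real m} \<times> {- real m..<real m})" for m
  proof (cases "m = 0")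
    case False
    \<comment> \<open>On either axis the density is at most e^m and the length is 2m, so c bounds
      the mass of the whole square.\<close>
    define c where "c = exp (real m) * (2 * real m) * (exp (real m) * (2 * real m))"
    define s where "s n i = - real m + real i * (2 * real m / real (Suc n))" for n i
    define R where "R n i = {- real m..<real m} \<times> {s n i..<s n (Suc i)}" for n i
    define U where "U n = (\<Union>i<Suc n. {\<omega>\<in>space M. ecount (\<Xi> \<omega> \<inter> R n i) \<ge> 2})" for n
    have R: "R n i \<in> sets borel" for n i unfolding R_def by (intro borel_Times2) simp_all
    have s: "- real m \<le> s n i" "s n (Suc i) - s n i = 2 * real m / real (Suc n)" "s n i \<le> s n (Suc i)" for n i
    proof -
      show *: "s n (Suc i) - s n i = 2 * real m / real (Suc n)" 
        unfolding s_def of_nat_Suc[of i] distrib_right by simp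
      have "0 \<le> 2 * real m / real (Suc n)" by simp
      then show "s n i \<le> s n (Suc i)" using * by linarith
    qed (simp add: s_def)
    have "emeasure \<mu> (R n i) \<le> ennreal (c / real (Suc n))" for n i
    proof -
      have "emeasure \<mu> (R n i) \<le> emeasure exp_measure {- real m..<real m} * emeasure exp_measure {s n i..<s n (Suc i)}"
        unfolding R_def assms by (rule emeasure_intensity_Times_le) simp_all
      also have "\<dots> \<le> ennreal (exp (real m) * (real m - - real m)) * ennreal (exp (real m) * (s n (Suc i) - s n i))"
        using s by (intro mult_mono exp_measure_atLeastLessThan_le) auto
      also have "\<dots> = ennreal (c / real (Suc n))"
        unfolding s(2) by (subst ennreal_mult[symmetric]) (auto simp: c_def)
      finally show ?thesis .
    qed
    then have p: "prob {\<omega>\<in>space M. ecount (\<Xi> \<omega> \<inter> R n i) \<ge> 2} \<le> (c / real (Suc n))\<^sup>2" for n i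
      by (intro prob_ecount_ge_2 R) (simp_all add: c_def)
    have ev: "{\<omega>\<in>space M. ecount (\<Xi> \<omega> \<inter> R n i) \<ge> 2} \<in> events" for n i
      by (rule sets_ecount[OF R])
    then have U: "U n \<in> events" for n unfolding U_def by (intro sets.finite_UN) auto
    have PU: "prob (U n) \<le> c\<^sup>2 / real (Suc n)" for n
    proof -
      have "prob (U n) \<le> (\<Sum>i<Suc n. prob {\<omega>\<in>space M. ecount (\<Xi> \<omega> \<inter> R n i) \<ge> 2})"
        unfolding U_def using ev by (intro finite_measure_subadditive_finite) auto
      also have "\<dots> \<le> (\<Sum>i<Suc n. (c / real (Suc n))\<^sup>2)" by (intro sum_mono p)
      also have "\<dots> = c\<^sup>2 / real (Suc n)" by (simp add: power2_eq_square del: of_nat_Suc)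
      finally show ?thesis .
    qed
    have I: "(\<Inter>n. U n) \<in> events" using U by (intro sets.countable_INT') (blast | simp)+
    have "prob (\<Inter>n. U n) \<le> 0"
    proof (rule LIMSEQ_le_const)
      show "(\<lambda>n. c\<^sup>2 / real (Suc n)) \<longlonglongrightarrow> 0" by real_asymp
      have "prob (\<Inter>n. U n) \<le> prob (U n)" for n using U by (intro finite_measure_mono) auto
      then show "\<exists>N. \<forall>n\<ge>N. prob (\<Inter>n. U n) \<le> c\<^sup>2 / real (Suc n)" using PU order_trans by blast
    qed
    then have "(\<Inter>n. U n) \<in> null_sets M"
      using I by (intro null_setsI) (simp add: emeasure_eq_measure measure_le_0_iff)
    then have "AE \<omega> in M. \<omega> \<notin> (\<Inter>n. U n)" by (rule AE_not_in)
    then show ?thesis using AE_space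
    proof eventually_elim
      case (elim \<omega>)
      then obtain n where n: "\<omega> \<notin> U n" by auto
      show ?case
      proof (rule inj_onI, rule ccontr)
        fix x y assume x: "x \<in> \<Xi> \<omega> \<inter> {- real m..<real m} \<times> {- real m..<real m}"
          and y: "y \<in> \<Xi> \<omega> \<inter> {- real m..<real m} \<times> {- real m..<real m}"
          and xy: "snd x = snd y" "x \<noteq> y"
        define w where "w = 2 * real m / real (Suc n)"
        have w: "w > 0" using False by (simp add: w_def)
        define i where "i = nat \<lfloor>(snd x + real m) / w\<rfloor>"
        have q: "0 \<le> (snd x + real m) / w" using x w by auto
        have i: "real i \<le> (snd x + real m) / w" "(snd x + real m) / w < real i + 1"
          using q unfolding i_def by linarith+
        have s_eq: "s n j = real j * w - real m" for j by (simp add: s_def w_def)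
        have "real i * w \<le> snd x + real m" "snd x + real m < (real i + 1) * w"
          using i w by (simp_all only: pos_le_divide_eq pos_divide_less_eq)
        then have sx: "s n i \<le> snd x" "snd x < s n (Suc i)"
          unfolding s_eq of_nat_Suc by (simp_all add: algebra_simps)
        have "(snd x + real m) / w < real (Suc n)"
          using x w False by (auto simp: pos_divide_less_eq w_def simp del: of_nat_Suc)
        with i have "i < Suc n" by linarith
        moreover have "x \<in> \<Xi> \<omega> \<inter> R n i" "y \<in> \<Xi> \<omega> \<inter> R n i"
          using x y sx xy by (auto simp: R_def mem_Times_iff)
        then have "ecount (\<Xi> \<omega> \<inter> R n i) \<ge> 2" using xy by (intro ecount_ge_2I)
        ultimately show False using n elim by (auto simp: U_def)
      qed
    qed
  qed simp
  then have "AE \<omega> in M. \<forall>m. inj_on snd (\<Xi> \<omega> \<inter> {- real m..<real m} \<times> {- real m..<real m})"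
    by (subst AE_all_countable) blast
  then show ?thesis
  proof eventually_elim
    case (elim \<omega>)
    show ?case
    proof (rule inj_onI)
      fix x y assume xy: "x \<in> \<Xi> \<omega>" "y \<in> \<Xi> \<omega>" "snd x = snd y"
      obtain m :: nat where m: "\<bar>fst x\<bar> + \<bar>fst y\<bar> + \<bar>snd x\<bar> < real m" using reals_Archimedean2 by blast
      then have "x \<in> \<Xi> \<omega> \<inter> {- real m..<real m} \<times> {- real m..<real m}"
          "y \<in> \<Xi> \<omega> \<inter> {- real m..<real m} \<times> {- real m..<real m}"
        using xy by (auto simp: mem_Times_iff)
      then show "x = y" using elim[rule_format, of m] xy(3) by (auto dest: inj_onD)
    qed
  qed
qed

text \<open>The bound \<open>snd y < g / 2\<close> matters: above that height \<open>nat\<close>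
  would send both indices to 0.\<close>

lemma cell_index_less:
  assumes d: "d > 0" and y: "snd y < g / 2" and x: "snd y + d \<le> snd x"
  shows "cell_index g d x < cell_index g d y"
proof -
  have "(g / 2 - snd x + d) / d \<le> (g / 2 - snd y) / d" using d x by (intro divide_right_mono) simp_all
  then have "(g / 2 - snd x) / d + 1 \<le> (g / 2 - snd y) / d" using d by (simp add: add_divide_distrib)
  moreover have "0 < (g / 2 - snd y) / d" using d y by simp
  ultimately show ?thesis unfolding cell_index_def by linarith
qed

lemma separation_finite:
  fixes Z :: "real set"
  assumes "finite Z"
  shows "\<exists>\<delta>>0. \<forall>a\<in>Z. \<forall>b\<in>Z. a < b \<longrightarrow> a + \<delta> \<le> b"
proof -
  \<comment> \<open>The inserted 1 gives \<open>Min\<close> a value when Z has no two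
    elements.\<close>
  let ?D = "insert 1 ((\<lambda>(a, b). b - a) ` {(a, b)\<in>Z \<times> Z. a < b})"
  have "{(a, b)\<in>Z \<times> Z. a < b} \<subseteq> Z \<times> Z" by auto
  then have fin: "finite ?D" using assms by (intro finite.insertI finite_imageI) (auto intro: finite_subset)
  then have "Min ?D > 0" by (subst Min_gr_iff) auto
  moreover have "a + Min ?D \<le> b" if "a \<in> Z" "b \<in> Z" "a < b" for a b
  proof -
    have "b - a \<in> ?D" using that by force
    with fin have "Min ?D \<le> b - a" by (rule Min_le)
    then show ?thesis by simp
  qed
  ultimately show ?thesis by blast
qed

text \<open>Not being dominated by x bounds the abscissa from below, not being dominated by r bounds
  the height from below, and x(g) bounds both from above.\<close>

lemma finite_dominated_maxima:
  assumes fin: "\<And>B. bounded B \<Longrightarrow> finite (S \<inter> B)"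
    and left: "x \<in> S" "fst x \<le> g / 2" "g / 2 \<le> snd x"
    and right: "r \<in> S" "g / 2 < fst r"
  shows "finite (dominated_maxima g S)"
proof -
  have "dominated_maxima g S \<subseteq> S \<inter> ({fst x..g/2} \<times> {snd r..g/2})"
  proof
    fix y assume "y \<in> dominated_maxima g S"
    then have y: "y \<in> S" "\<not> y \<prec> x" "\<not> y \<prec> r" "fst y < g / 2" "snd y < g / 2"
      using left right by (auto simp: dominated_maxima_def maxima_def diag_pt_def dominated_def)
    then show "y \<in> S \<inter> ({fst x..g/2} \<times> {snd r..g/2})"
      using left right by (auto simp: dominated_def mem_Times_iff)
  qed
  then show ?thesis by (rule finite_subset) (intro fin bounded_Times, simp_all)
qed

text \<open>The dominated maxima are finitely many and lie strictly above the highest right-hand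
  point r. Once d is below the least difference of these heights, every maximum has a cell of its
  own, before that of r, and counting cells is counting maxima. The index i is determined by r lying
  in cell i + 1.\<close>

lemma dominated_maxima_eq_card_records:
  assumes fin: "\<And>B. bounded B \<Longrightarrow> finite (S \<inter> B)"
    and line: "\<And>z. z \<in> S \<Longrightarrow> fst z \<noteq> g / 2"
    and inj: "inj_on snd S"
    and left: "S \<inter> {..g/2} \<times> {g/2..} \<noteq> {}"
    and right: "S \<inter> {g/2<..} \<times> {..<g/2} \<noteq> {}"
    and right_fin: "\<And>h. h \<le> g / 2 \<Longrightarrow> finite (S \<inter> right_part g h)"
    and corner: "S \<inter> right_part g (g / 2) = {}"
  shows "\<exists>\<delta>>0. \<forall>d. 0 < d \<and> d < \<delta> \<and> (\<forall>i j. S \<inter> strip g d (level g d i) j \<noteq> {}) \<longrightarrow>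
    (\<forall>k. (\<exists>i. S \<inter> right_part g (level g d i) = {} \<and> S \<inter> right_part g (level g d (Suc i)) \<noteq> {}
        \<and> card (records (strip_depth g d (level g d i) S) i) = k)
      \<longleftrightarrow> ecount (dominated_maxima g S) = enat k)"
proof -
  let ?T = "dominated_maxima g S"
  obtain x where x: "x \<in> S" "fst x \<le> g / 2" "g / 2 \<le> snd x" using left by auto
  obtain r0 where r0: "r0 \<in> S" "g / 2 < fst r0" "snd r0 < g / 2" using right by auto
  \<comment> \<open>A highest right-hand point exists because only finitely many of them are at
    least as high as r0.\<close>
  have "r0 \<in> S \<inter> right_part g (snd r0)" using r0 by (auto simp: right_part_def mem_Times_iff)
  moreover have "finite (S \<inter> right_part g (snd r0))" using r0 by (intro right_fin) simp
  ultimately obtain r where r: "r \<in> S \<inter> right_part g (snd r0)"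
      "\<And>z. z \<in> S \<inter> right_part g (snd r0) \<Longrightarrow> snd z \<le> snd r"
    using Max_in[of "snd ` (S \<inter> right_part g (snd r0))"] Max_ge[of "snd ` (S \<inter> right_part g (snd r0))"]
    by (metis (no_types, lifting) empty_iff finite_imageI image_iff image_is_empty)
  have rS: "r \<in> S" "g / 2 < fst r" "snd r0 \<le> snd r" using r by (auto simp: right_part_def)
  have r_lt: "snd r < g / 2"
    using corner rS by (cases r) (auto simp: right_part_def not_le[symmetric])
  have r_max: "snd z \<le> snd r" if "z \<in> S" "g / 2 < fst z" for z
    using r(2)[of z] that rS(3) by (cases "snd r0 \<le> snd z") (auto simp: right_part_def mem_Times_iff)
  have void: "S \<inter> right_part g h = {} \<longleftrightarrow> snd r < h" for h
    using r_max rS by (auto simp: right_part_def mem_Times_iff not_le[symmetric]) (meson order_trans)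
  have T: "y \<in> S" "fst y < g / 2" "snd y < g / 2" "snd r < snd y" if "y \<in> ?T" for y
  proof -
    show y: "y \<in> S" "fst y < g / 2" "snd y < g / 2"
      using that by (auto simp: dominated_maxima_def maxima_def diag_pt_def dominated_def)
    have "\<not> y \<prec> r" using that rS by (auto simp: dominated_maxima_def maxima_def)
    then have "snd r \<le> snd y" using y rS by (auto simp: dominated_def)
    moreover have "snd r \<noteq> snd y" using inj_onD[OF inj, of r y] y rS by auto
    ultimately show "snd r < snd y" by simp
  qed
  have finT: "finite ?T" using fin x rS by (intro finite_dominated_maxima[of S x g r]) auto
  \<comment> \<open>The height of r takes part so that no maximum falls into the cell of r, which
    the count omits.\<close>
  then obtain \<delta> where \<delta>: "\<delta> > 0"
    "\<And>a b. a \<in> insert (snd r) (snd ` ?T) \<Longrightarrow> b \<in> insert (snd r) (snd ` ?T) \<Longrightarrow> a < b \<Longrightarrow> a + \<delta> \<le> b"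
    using separation_finite[of "insert (snd r) (snd ` ?T)"] by blast
  show ?thesis
  proof (intro exI[of _ \<delta>] conjI allI impI \<delta>(1), elim conjE)
    fix d k assume d: "0 < d" "d < \<delta>" and ne: "\<forall>i j. S \<inter> strip g d (level g d i) j \<noteq> {}"
    obtain i0 where i0: "cell_index g d r = Suc i0"
      using cell_index_pos[OF d(1) r_lt] by (cases "cell_index g d r") auto
    have i_iff: "S \<inter> right_part g (level g d i) = {} \<and> S \<inter> right_part g (level g d (Suc i)) \<noteq> {} \<longleftrightarrow> i = i0" for i
      using cell_index_eq_Suc_iff[OF d(1), of g r i] i0 unfolding void by auto
    have less: "cell_index g d a < cell_index g d b"
      if "a \<in> insert r ?T" "b \<in> insert r ?T" "snd b < snd a" for a b
    proof (rule cell_index_less[OF d(1)])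
      show "snd b < g / 2" using that(2) T(3)[of b] r_lt by (cases "b = r") simp_all
      show "snd b + d \<le> snd a" using \<delta>(2)[of "snd b" "snd a"] that d by fastforce
    qed
    have "inj_on (cell_index g d) ?T"
    proof (rule inj_onI)
      fix a b assume ab: "a \<in> ?T" "b \<in> ?T" "cell_index g d a = cell_index g d b"
      then have "snd a = snd b" using less[of a b] less[of b a] by (cases "snd a" "snd b" rule: linorder_cases) auto
      then show "a = b" using T(1) ab by (intro inj_onD[OF inj])
    qed
    moreover have "cell_index g d ` ?T \<subseteq> {1..i0}"
    proof
      fix j assume "j \<in> cell_index g d ` ?T"
      then obtain y where y: "y \<in> ?T" "j = cell_index g d y" by auto
      then show "j \<in> {1..i0}" using less[of y r] T[OF y(1)] i0 cell_index_pos[OF d(1), of y g] by auto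
    qed
    moreover have "records (strip_depth g d (level g d i0) S) i0 = cell_index g d ` ?T \<inter> {1..i0}"
      using i_iff[of i0] ne d line by (intro records_strip_depth fin) auto
    ultimately have "card (records (strip_depth g d (level g d i0) S) i0) = card ?T"
      by (simp add: Int_absorb2 card_image)
    moreover have "(\<exists>i. S \<inter> right_part g (level g d i) = {} \<and> S \<inter> right_part g (level g d (Suc i)) \<noteq> {} \<and> Q i)
        \<longleftrightarrow> Q i0" for Q
      unfolding conj_assoc[symmetric] i_iff by simp
    ultimately show "(\<exists>i. S \<inter> right_part g (level g d i) = {} \<and> S \<inter> right_part g (level g d (Suc i)) \<noteq> {}
        \<and> card (records (strip_depth g d (level g d i) S) i) = k) \<longleftrightarrow> ecount ?T = enat k"
      using finT by (simp add: ecount_def)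
  qed
qed

section \<open>Measurability of the number of maxima\<close>

lemma dominated_interpolate:
  fixes y z :: "real \<times> real"
  assumes "y \<prec> z" shows "\<exists>p\<in>\<rat> \<times> \<rat>. y \<prec> p \<and> p \<prec> z"
proof -
  obtain a where "a \<in> \<rat>" "fst y < a" "a < fst z" using assms Rats_dense_in_real unfolding dominated_def by blast
  moreover obtain b where "b \<in> \<rat>" "snd y < b" "b < snd z" using assms Rats_dense_in_real unfolding dominated_def by blast
  ultimately show ?thesis by (intro bexI[of _ "(a, b)"]) (auto simp: dominated_def)
qed

lemma dominated_trans: "(x :: real \<times> real) \<prec> y \<Longrightarrow> y \<prec> z \<Longrightarrow> x \<prec> z"
  by (auto simp: dominated_def)

text \<open>A dominating point can be separated from y by a rational p, and since y is the only
  point of S in R, \<open>y \<prec> p\<close> says that S meets R below p. Maximality becomes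
  countably many emptiness conditions on fixed sets.\<close>

lemma maximal_iff_rational:
  fixes y :: "real \<times> real"
  assumes "S \<inter> R = {y}"
  shows "y \<in> maxima S \<longleftrightarrow>
    (\<forall>p\<in>\<rat> \<times> \<rat>. S \<inter> (R \<inter> {z. z \<prec> p}) = {} \<or> S \<inter> {z. p \<prec> z} = {})"
proof -
  have "(\<exists>z\<in>S. y \<prec> z) \<longleftrightarrow> (\<exists>p\<in>\<rat> \<times> \<rat>. y \<prec> p \<and> (\<exists>z\<in>S. p \<prec> z))"
    using dominated_interpolate dominated_trans by blast
  moreover have "S \<inter> (R \<inter> {z. z \<prec> p}) = {} \<longleftrightarrow> \<not> y \<prec> p" for p
  proof -
    have "S \<inter> (R \<inter> {z. z \<prec> p}) = {y} \<inter> {z. z \<prec> p}" using assms by blast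
    then show ?thesis by simp
  qed
  moreover have "y \<in> S" using assms by auto
  ultimately show ?thesis unfolding maxima_def by blast
qed

text \<open>
  Local finiteness isolates every point in a set of a countable basis, and maximality of an
  isolated point is tested on rational points.
\<close>

lemma (in poisson_points) sets_ecount_dominated_maxima:
  "{\<omega>\<in>space M. enat k \<le> ecount (dominated_maxima g (\<Xi> \<omega>))} \<in> events"
proof -
  obtain B :: "(real \<times> real) set set" where B: "countable B" "topological_basis B"
    using ex_countable_basis by blast
  define D where "D = {z. z \<prec> diag_pt g}"
  have D: "D \<in> sets borel" unfolding D_def by (rule dominated_sets)
  have B_borel: "R \<in> sets borel" if "R \<in> B" for R
    using topological_basis_open[OF B(2) that] by (rule borel_open)
  \<comment> \<open>R isolates one point among those dominated by x(g), and this point is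
    maximal.\<close>
  define Q where "Q R S \<longleftrightarrow> ecount (S \<inter> (R \<inter> D)) = 1 \<and>
    (\<forall>p\<in>\<rat> \<times> \<rat>. S \<inter> (R \<inter> D \<inter> {z. z \<prec> p}) = {} \<or> S \<inter> {z. p \<prec> z} = {})" for R S
  have Q_iff: "Q R S \<longleftrightarrow> (\<exists>y. S \<inter> (R \<inter> D) = {y} \<and> y \<in> maxima S)" for R S
  proof -
    have "ecount (S \<inter> (R \<inter> D)) = 1 \<longleftrightarrow> (\<exists>y. S \<inter> (R \<inter> D) = {y})"
      by (auto simp: one_enat_def ecount_eq_enat_iff card_1_singleton_iff)
    then show ?thesis unfolding Q_def using maximal_iff_rational[of S "R \<inter> D"] by metis
  qed
  \<comment> \<open>The second condition makes different members of F isolate different points, so F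
    has as many members as it certifies maxima.\<close>
  define P where "P F S \<longleftrightarrow> (\<forall>R\<in>F. Q R S) \<and>
    (\<forall>R\<in>F. \<forall>R'\<in>F. R = R' \<or> S \<inter> (R \<inter> R' \<inter> D) = {})" for F S
  have iff: "enat k \<le> ecount (dominated_maxima g S) \<longleftrightarrow> (\<exists>F\<in>{F. F \<subseteq> B \<and> finite F}. card F = k \<and> P F S)"
    if fin: "\<And>A. bounded A \<Longrightarrow> finite (S \<inter> A)" for S
  proof
    assume "enat k \<le> ecount (dominated_maxima g S)"
    then have "\<exists>T\<subseteq>dominated_maxima g S. finite T \<and> card T = k"
      by (cases "finite (dominated_maxima g S)")
        (auto simp: ecount_def dest: obtain_subset_with_card_n infinite_arbitrarily_large)
    then obtain T where T: "T \<subseteq> dominated_maxima g S" "finite T" "card T = k" by blast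
    have "\<exists>R\<in>B. S \<inter> R = {y}" if "y \<in> T" for y
    proof -
      have y: "y \<in> S" using that T by (auto simp: dominated_maxima_def maxima_def)
      \<comment> \<open>Removing the finitely many other points from a ball leaves an open
        neighbourhood of y, inside which a basis set is found.\<close>
      have "finite (S \<inter> ball y 1 - {y})" using fin by simp
      then have "open (ball y 1 - (S \<inter> ball y 1 - {y}))"
        by (intro open_Diff finite_imp_closed) simp_all
      then obtain R where "R \<in> B" "y \<in> R" "R \<subseteq> ball y 1 - (S \<inter> ball y 1 - {y})"
        by (rule topological_basisE[OF B(2), of _ y]) simp_all
      then show ?thesis using y by (intro bexI[of _ R]) auto
    qed
    then obtain f where f: "\<And>y. y \<in> T \<Longrightarrow> f y \<in> B" "\<And>y. y \<in> T \<Longrightarrow> S \<inter> f y = {y}" by metis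
    have "inj_on f T" using f(2) by (intro inj_onI) (metis singleton_inject)
    moreover have "Q (f y) S" if "y \<in> T" for y
    proof -
      have "y \<in> D" "y \<in> maxima S" using that T(1) by (auto simp: D_def dominated_maxima_def)
      then have "S \<inter> (f y \<inter> D) = {y}" using f(2)[OF that] by blast
      then show ?thesis unfolding Q_iff using \<open>y \<in> maxima S\<close> by blast
    qed
    moreover have "S \<inter> (f y \<inter> f z \<inter> D) = {}" if "y \<in> T" "z \<in> T" "f y \<noteq> f z" for y z
      using f(2)[OF that(1)] f(2)[OF that(2)] that(3) by auto
    ultimately have "card (f ` T) = k" "P (f ` T) S"
      using T(3) unfolding P_def ball_simps by (blast intro: card_image)+
    moreover have "f ` T \<subseteq> B" "finite (f ` T)" using T(2) f(1) by blast+
    ultimately show "\<exists>F\<in>{F. F \<subseteq> B \<and> finite F}. card F = k \<and> P F S" by blast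
  next
    assume "\<exists>F\<in>{F. F \<subseteq> B \<and> finite F}. card F = k \<and> P F S"
    then obtain F where F: "finite F" "card F = k" "P F S" by auto
    then have "\<forall>R\<in>F. \<exists>y. S \<inter> (R \<inter> D) = {y} \<and> y \<in> maxima S"
      unfolding P_def Q_iff by blast
    then obtain f where f: "\<And>R. R \<in> F \<Longrightarrow> S \<inter> (R \<inter> D) = {f R}" "\<And>R. R \<in> F \<Longrightarrow> f R \<in> maxima S" by metis
    have "inj_on f F"
    proof (rule inj_onI, rule ccontr)
      fix R R' assume R: "R \<in> F" "R' \<in> F" "f R = f R'" "R \<noteq> R'"
      then have "f R \<in> S \<inter> (R \<inter> R' \<inter> D)" using f(1)[of R] f(1)[of R'] by auto
      then show False using R F(3) unfolding P_def by blast
    qed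
    then have "card (f ` F) = k" using F by (simp add: card_image)
    moreover have "f ` F \<subseteq> dominated_maxima g S"
      using f by (fastforce simp: dominated_maxima_def D_def)
    ultimately show "enat k \<le> ecount (dominated_maxima g S)"
      by (auto simp: ecount_def dest: card_mono)
  qed
  have Q_sets: "{\<omega>\<in>space M. Q R (\<Xi> \<omega>)} \<in> events" if "R \<in> B" for R
    unfolding Q_def
  proof (intro sets.sets_Collect_conj sets.sets_Collect_countable_All')
    show "{\<omega>\<in>space M. ecount (\<Xi> \<omega> \<inter> (R \<inter> D)) = 1} \<in> events"
      by (intro sets_ecount sets.Int B_borel[OF that] D)
    show "{\<omega>\<in>space M. \<Xi> \<omega> \<inter> (R \<inter> D \<inter> {z. z \<prec> p}) = {} \<or> \<Xi> \<omega> \<inter> {z. p \<prec> z} = {}} \<in> events" for p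
      by (intro sets.sets_Collect_disj sets_empty sets.Int B_borel[OF that] D dominated_sets)
  qed (intro countable_SIGMA countable_rat)
  have P_sets: "{\<omega>\<in>space M. P F (\<Xi> \<omega>)} \<in> events" if F: "F \<subseteq> B" "finite F" for F
    unfolding P_def
  proof (intro sets.sets_Collect_conj sets.sets_Collect_finite_All F(2))
    fix R assume "R \<in> F"
    then have R: "R \<in> B" using F by blast
    show "{\<omega>\<in>space M. Q R (\<Xi> \<omega>)} \<in> events" by (rule Q_sets[OF R])
    fix R' assume "R' \<in> F"
    then have R': "R' \<in> B" using F by blast
    show "{\<omega>\<in>space M. R = R' \<or> \<Xi> \<omega> \<inter> (R \<inter> R' \<inter> D) = {}} \<in> events"
      by (intro sets.sets_Collect_disj sets.sets_Collect_const sets_empty sets.Int B_borel[OF R] B_borel[OF R'] D)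
  qed
  have "{\<omega>\<in>space M. \<exists>F\<in>{F. F \<subseteq> B \<and> finite F}. card F = k \<and> P F (\<Xi> \<omega>)} \<in> events"
  proof (intro sets.sets_Collect_countable_Ex'
        sets.sets_Collect_conj sets.sets_Collect_const)
    show "{\<omega>\<in>space M. P F (\<Xi> \<omega>)} \<in> events" if "F \<in> {F. F \<subseteq> B \<and> finite F}" for F
      using that by (intro P_sets) simp_all
  qed (use countable_Collect_finite_subset[OF B(1)] in \<open>simp add: conj_commute\<close>)
  moreover have "{\<omega>\<in>space M. enat k \<le> ecount (dominated_maxima g (\<Xi> \<omega>))}
      = {\<omega>\<in>space M. \<exists>F\<in>{F. F \<subseteq> B \<and> finite F}. card F = k \<and> P F (\<Xi> \<omega>)}"
    using iff[OF finite_points] by blast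
  ultimately show ?thesis by (simp only:)
qed

lemma num_dominated_maxima_eq: "num_dominated_maxima g S = ecount (dominated_maxima g S)"
  by (simp add: num_dominated_maxima_def dominated_maxima_def)

lemma (in poisson_points) measurable_num_dominated_maxima:
  "(\<lambda>\<omega>. num_dominated_maxima g (\<Xi> \<omega>)) \<in> measurable M (count_space UNIV)"
proof -
  let ?K = "\<lambda>\<omega>. num_dominated_maxima g (\<Xi> \<omega>)"
  define E where "E k = {\<omega>\<in>space M. enat k \<le> ?K \<omega>}" for k
  have E: "E k \<in> events" for k
    unfolding E_def num_dominated_maxima_eq by (rule sets_ecount_dominated_maxima)
  have "?K -` {a} \<inter> space M \<in> events" for a
  proof (cases a)
    case (enat k)
    have "?K -` {a} \<inter> space M = E k - E (Suc k)"
    proof -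
      have "n = enat k \<longleftrightarrow> enat k \<le> n \<and> \<not> enat (Suc k) \<le> n" for n by (cases n) auto
      then show ?thesis unfolding enat E_def by auto
    qed
    then show ?thesis using E by (simp only: sets.Diff)
  next
    case infinity
    have "?K -` {a} \<inter> space M = (\<Inter>k. E k)"
    proof -
      have "n = \<infinity> \<longleftrightarrow> (\<forall>k. enat k \<le> n)" for n
        by (cases n) (auto simp: not_le intro: lessI)
      then show ?thesis unfolding infinity E_def by auto
    qed
    moreover have "(\<Inter>k. E k) \<in> events" using E by (intro sets.countable_INT') (blast | simp)+
    ultimately show ?thesis by (simp only:)
  qed
  then show ?thesis
    by (subst measurable_count_space_eq2_countable) auto
qed

section \<open>Passage to the limit\<close>

text \<open>The index from which the events agree may depend on \<open>\<omega>\<close>; dominated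
  convergence of the indicators suffices.\<close>

lemma (in prob_space) tendsto_prob_AE_eventually:
  assumes "\<And>n. E n \<in> events" "F \<in> events"
    and ae: "AE \<omega> in M. \<forall>\<^sub>F n in sequentially. \<omega> \<in> E n \<longleftrightarrow> \<omega> \<in> F"
  shows "(\<lambda>n. prob (E n)) \<longlonglongrightarrow> prob F"
proof -
  have "(\<lambda>n. expectation (indicator (E n))) \<longlonglongrightarrow> (expectation (indicator F) :: real)"
  proof (rule integral_dominated_convergence[where w = "\<lambda>_. 1"])
    show "AE \<omega> in M. (\<lambda>n. indicator (E n) \<omega> :: real) \<longlonglongrightarrow> indicator F \<omega>"
      using ae
    proof eventually_elim
      case (elim \<omega>)
      then have "\<forall>\<^sub>F n in sequentially. indicator (E n) \<omega> = (indicator F \<omega> :: real)"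
        by eventually_elim (simp add: indicator_def)
      then show ?case by (rule tendsto_eventually)
    qed
  qed (use assms in \<open>auto simp: indicator_def\<close>)
  then show ?thesis using assms by simp
qed

lemma (in record_process) tendsto_prob_cell_records:
  "(\<lambda>n. prob (\<Union>i. cell_records (1 / real (Suc n)) i k))
    \<longlonglongrightarrow> prob {\<omega>\<in>space M. num_dominated_maxima g (\<Xi> \<omega>) = enat k}"
proof (rule tendsto_prob_AE_eventually)
  show "(\<Union>i. cell_records (1 / real (Suc n)) i k) \<in> events" for n
    using sets_cell_records by (intro sets.countable_UN) auto
  show "{\<omega>\<in>space M. num_dominated_maxima g (\<Xi> \<omega>) = enat k} \<in> events"
    using measurable_sets[OF measurable_num_dominated_maxima[of g], of "{enat k}"]
    by (simp add: vimage_def Int_def conj_commute)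
  \<comment> \<open>With d = 1/(n+1) only countably many strips occur, so all of them are nonempty
    almost surely at once, before the random bound on d is chosen.\<close>
  have strips: "AE \<omega> in M. \<forall>n i j. \<Xi> \<omega> \<inter> strip g (1 / real (Suc n)) (level g (1 / real (Suc n)) i) j \<noteq> {}"
    unfolding AE_all_countable using AE_strip_nonempty by (auto simp: AE_all_countable)
  have left: "AE \<omega> in M. infinite (\<Xi> \<omega> \<inter> {..g/2} \<times> {g/2..})"
    by (intro AE_infinite borel_Times2, simp_all, subst emeasure_left)
      (auto simp: exp_measure_atMost exp_measure_atLeast ennreal_top_mult)
  have right: "AE \<omega> in M. infinite (\<Xi> \<omega> \<inter> {g/2<..} \<times> {..<g/2})"
  proof (rule AE_infinite)
    show *: "{g/2<..} \<times> {..<g/2} \<in> sets borel" by (intro borel_Times2) simp_all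
    have "{g/2<..} \<times> {..<g/2} - {z. diag_pt g \<prec> z} = {g/2<..} \<times> {..<g/2}"
      by (auto simp: dominated_def diag_pt_def)
    from emeasure_intensity_Times[OF _ _ * this]
    show "emeasure (intensity g) ({g/2<..} \<times> {..<g/2}) = \<infinity>"
      by (simp add: exp_measure_greaterThan exp_measure_lessThan ennreal_mult_top)
  qed
  have "AE \<omega> in M. finite (\<Xi> \<omega> \<inter> right_part g (g / 2 - real m))" for m
    by (intro AE_finite right_part_borel) (simp add: emeasure_right_part)
  then have right_fin: "AE \<omega> in M. \<forall>m. finite (\<Xi> \<omega> \<inter> right_part g (g / 2 - real m))"
    unfolding AE_all_countable by blast
  have corner: "AE \<omega> in M. \<Xi> \<omega> \<inter> right_part g (g / 2) = {}"
    by (intro AE_empty right_part_borel) (simp add: emeasure_right_part)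
  show "AE \<omega> in M. \<forall>\<^sub>F n in sequentially. \<omega> \<in> (\<Union>i. cell_records (1 / real (Suc n)) i k)
      \<longleftrightarrow> \<omega> \<in> {\<omega>\<in>space M. num_dominated_maxima g (\<Xi> \<omega>) = enat k}"
    using strips left right right_fin corner AE_off_line AE_inj_on_snd[OF refl] AE_space
  proof eventually_elim
    case (elim \<omega>)
    let ?S = "\<Xi> \<omega>"
    note strips_\<omega> = elim(1)
    have fin: "finite (?S \<inter> right_part g h)" for h
    proof -
      obtain m :: nat where "g / 2 - h < real m" using reals_Archimedean2 by blast
      then have "right_part g h \<subseteq> right_part g (g / 2 - real m)" by (auto simp: right_part_def)
      then show ?thesis using elim(4) by (meson Int_mono finite_subset order_refl)
    qed
    have "\<exists>\<delta>>0. \<forall>d. 0 < d \<and> d < \<delta> \<and> (\<forall>i j. ?S \<inter> strip g d (level g d i) j \<noteq> {}) \<longrightarrow>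
      (\<forall>k. (\<exists>i. ?S \<inter> right_part g (level g d i) = {} \<and> ?S \<inter> right_part g (level g d (Suc i)) \<noteq> {}
          \<and> card (records (strip_depth g d (level g d i) ?S) i) = k)
        \<longleftrightarrow> ecount (dominated_maxima g ?S) = enat k)"
    proof (rule dominated_maxima_eq_card_records)
      show "?S \<inter> {..g/2} \<times> {g/2..} \<noteq> {}" using elim(2) by (metis finite.emptyI)
      show "?S \<inter> {g/2<..} \<times> {..<g/2} \<noteq> {}" using elim(3) by (metis finite.emptyI)
      show "finite (?S \<inter> B)" if "bounded B" for B using finite_points elim that by blast
      show "fst z \<noteq> g / 2" if "z \<in> ?S" for z using elim that by blast
      show "inj_on snd ?S" by fact
      show "finite (?S \<inter> right_part g h)" for h by (rule fin)
      show "?S \<inter> right_part g (g / 2) = {}" by fact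
    qed
    then obtain \<delta> where \<delta>: "\<delta> > 0"
      "\<forall>d. 0 < d \<and> d < \<delta> \<and> (\<forall>i j. ?S \<inter> strip g d (level g d i) j \<noteq> {}) \<longrightarrow>
      (\<forall>k. (\<exists>i. ?S \<inter> right_part g (level g d i) = {} \<and> ?S \<inter> right_part g (level g d (Suc i)) \<noteq> {}
          \<and> card (records (strip_depth g d (level g d i) ?S) i) = k)
        \<longleftrightarrow> ecount (dominated_maxima g ?S) = enat k)"
      by (elim exE conjE) (rule that)
    have "(\<lambda>n. 1 / real (Suc n)) \<longlonglongrightarrow> 0" by real_asymp
    then have "\<forall>\<^sub>F n in sequentially. 1 / real (Suc n) < \<delta>"
      using \<delta>(1) by (rule order_tendstoD)
    then show ?case
    proof eventually_elim
      case (elim n)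
      have "\<omega> \<in> (\<Union>i. cell_records (1 / real (Suc n)) i k) \<longleftrightarrow>
        (\<exists>i. ?S \<inter> right_part g (level g (1 / real (Suc n)) i) = {}
          \<and> ?S \<inter> right_part g (level g (1 / real (Suc n)) (Suc i)) \<noteq> {}
          \<and> card (records (strip_depth g (1 / real (Suc n)) (level g (1 / real (Suc n)) i) ?S) i) = k)"
        using \<open>\<omega> \<in> space M\<close> by (auto simp only: cell_records_def void_records_def)
      also have "\<dots> \<longleftrightarrow> ecount (dominated_maxima g ?S) = enat k"
      proof (rule \<delta>(2)[THEN spec, THEN mp, THEN spec], intro conjI)
        show "1 / real (Suc n) < \<delta>" by (rule elim)
        show "\<forall>i j. ?S \<inter> strip g (1 / real (Suc n)) (level g (1 / real (Suc n)) i) j \<noteq> {}"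
          using strips_\<omega> by (rule spec)
      qed simp
      finally show ?case using \<open>\<omega> \<in> space M\<close> by (simp add: num_dominated_maxima_eq)
    qed
  qed
qed

section \<open>From binomial weights to the Poisson mixture\<close>

lemma binom_prob_Suc_right:
  assumes "p < 1"
  shows "binom_prob p m (Suc k) = binom_prob p m k * ((real m - real k) * p / ((real k + 1) * (1 - p)))"
proof (cases "k < m")
  case True
  have "real (m choose Suc k) * (real k + 1) = real (m choose k) * (real m - real k)"
  proof -
    have "(m choose Suc k) * Suc k = (m choose k) * (m - k)"
      using binomial_absorption[of k m] binomial_absorb_comp[of m k] by (simp add: mult.commute)
    then have "real ((m choose Suc k) * Suc k) = real ((m choose k) * (m - k))" by simp
    then show ?thesis using True by (simp add: of_nat_diff algebra_simps)
  qed
  then have *: "real (m choose Suc k) = real (m choose k) * (real m - real k) / (real k + 1)"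
    by (simp add: field_simps)
  have "(1 - p) ^ (m - k) = (1 - p) * (1 - p) ^ (m - Suc k)"
    using True by (metis Suc_diff_Suc power_Suc)
  moreover have "a * b / r * (p * P) * Y = a * P * (q * Y) * (b * p / (r * q))"
    if "q \<noteq> 0" "r \<noteq> 0" for a b r P Y q :: real
    using that by (simp add: field_simps)
  ultimately show ?thesis using assms unfolding binom_prob_def * power_Suc by simp
next
  case False
  then show ?thesis by (cases "k = m") (auto simp: binom_prob_def binomial_eq_0)
qed

text \<open>The weight at 0 is exactly e^(-m/(n+1)), and the ratio of successive weights, (m - k) p
  / ((k + 1) (1 - p)), tends to x / (k + 1) because p is asymptotically 1/(n+1).\<close>

lemma tendsto_binom_prob_poisson:
  assumes m: "(\<lambda>n. real (m n) / real (Suc n)) \<longlonglongrightarrow> x"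
  shows "(\<lambda>n. binom_prob (1 - exp (- (1 / real (Suc n)))) (m n) k) \<longlonglongrightarrow> exp (- x) * x ^ k / fact k"
proof (induction k)
  case 0
  have "exp (- (1 / real (Suc n))) ^ m n = exp (- (real (m n) / real (Suc n)))" for n
    by (simp add: exp_of_nat_mult[symmetric])
  then show ?case
    using tendsto_exp[OF tendsto_minus[OF m]] by (simp add: binom_prob_def)
next
  case (Suc k)
  let ?p = "\<lambda>n. 1 - exp (- (1 / real (Suc n)))"
  have 1: "(\<lambda>n. (?p n * real (Suc n)) / exp (- (1 / real (Suc n)))) \<longlonglongrightarrow> 1"
    by real_asymp
  have 2: "(\<lambda>n. real (m n) / real (Suc n) - real k / real (Suc n)) \<longlonglongrightarrow> x - 0"
    by (intro tendsto_diff m) real_asymp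
  have "(\<lambda>n. binom_prob (?p n) (m n) k * ((real (m n) / real (Suc n) - real k / real (Suc n))
      * ((?p n * real (Suc n)) / exp (- (1 / real (Suc n)))) / (real k + 1)))
      \<longlonglongrightarrow> (exp (- x) * x ^ k / fact k) * ((x - 0) * 1 / (real k + 1))"
    by (intro tendsto_mult tendsto_divide Suc 1 2 tendsto_const) simp
  also have "(\<lambda>n. binom_prob (?p n) (m n) k * ((real (m n) / real (Suc n) - real k / real (Suc n))
      * ((?p n * real (Suc n)) / exp (- (1 / real (Suc n)))) / (real k + 1)))
      = (\<lambda>n. binom_prob (?p n) (m n) (Suc k))"
  proof
    fix n
    have "real (Suc n) > 0" by simp
    then show "binom_prob (?p n) (m n) k * ((real (m n) / real (Suc n) - real k / real (Suc n))
      * ((?p n * real (Suc n)) / exp (- (1 / real (Suc n)))) / (real k + 1)) = binom_prob (?p n) (m n) (Suc k)"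
      by (subst binom_prob_Suc_right) (simp_all add: diff_divide_distrib[symmetric] del: of_nat_Suc)
  qed
  finally show ?case by (simp add: field_simps)
qed

text \<open>Differences of tails are the probabilities of the values of the integer part of X/d. The
  sum over cells thus becomes an expectation on one fixed space, where d can tend to 0 under the
  integral.\<close>

lemma (in prob_space) sums_expectation_discretized:
  fixes X :: "'a \<Rightarrow> real" and b :: "nat \<Rightarrow> real"
  assumes [measurable]: "X \<in> borel_measurable M" and d: "d > 0"
    and b: "\<And>i. 0 \<le> b i" "\<And>i. b i \<le> 1"
    and pos: "AE \<omega> in M. 0 \<le> X \<omega>"
  shows "(\<lambda>i. (prob {\<omega>\<in>space M. real i * d \<le> X \<omega>} - prob {\<omega>\<in>space M. real (Suc i) * d \<le> X \<omega>}) * b i)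
    sums expectation (\<lambda>\<omega>. b (nat \<lfloor>X \<omega> / d\<rfloor>))"
proof -
  let ?J = "\<lambda>\<omega>. nat \<lfloor>X \<omega> / d\<rfloor>"
  define A where "A i = {\<omega>\<in>space M. ?J \<omega> = i}" for i
  have [measurable]: "A i \<in> events" for i unfolding A_def by measurable
  have PA: "prob (A i) = prob {\<omega>\<in>space M. real i * d \<le> X \<omega>} - prob {\<omega>\<in>space M. real (Suc i) * d \<le> X \<omega>}" for i
  proof -
    have "prob (A i) = prob ({\<omega>\<in>space M. real i * d \<le> X \<omega>} - {\<omega>\<in>space M. real (Suc i) * d \<le> X \<omega>})"
    proof (rule finite_measure_eq_AE)
      show "AE \<omega> in M. \<omega> \<in> A i \<longleftrightarrow> \<omega> \<in> {\<omega>\<in>space M. real i * d \<le> X \<omega>} - {\<omega>\<in>space M. real (Suc i) * d \<le> X \<omega>}"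
        using pos
      proof eventually_elim
        case (elim \<omega>)
        then have "0 \<le> X \<omega> / d" using d by simp
        then have "?J \<omega> = i \<longleftrightarrow> real i \<le> X \<omega> / d \<and> X \<omega> / d < real (Suc i)"
          by (simp add: nat_eq_iff floor_eq_iff add.commute)
        also have "\<dots> \<longleftrightarrow> real i * d \<le> X \<omega> \<and> X \<omega> < real (Suc i) * d"
          using d by (simp only: pos_le_divide_eq pos_divide_less_eq)
        finally show ?case by (auto simp: A_def)
      qed
    qed measurable
    also have "\<dots> = prob {\<omega>\<in>space M. real i * d \<le> X \<omega>} - prob {\<omega>\<in>space M. real (Suc i) * d \<le> X \<omega>}"
      using d by (intro finite_measure_Diff) (auto simp: algebra_simps intro: order_trans[rotated])
    finally show ?thesis .
  qed
  have E: "expectation (\<lambda>\<omega>. if i = ?J \<omega> then b i else 0) = b i * prob (A i)" for i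
  proof -
    have "expectation (\<lambda>\<omega>. if i = ?J \<omega> then b i else 0) = expectation (\<lambda>\<omega>. b i * indicator (A i) \<omega>)"
      by (intro Bochner_Integration.integral_cong) (auto simp: A_def indicator_def)
    then show ?thesis by simp
  qed
  have "(\<lambda>i. expectation (\<lambda>\<omega>. if i = ?J \<omega> then b i else 0))
      sums expectation (\<lambda>\<omega>. \<Sum>i. if i = ?J \<omega> then b i else 0)"
  proof (rule sums_integral)
    show int: "integrable M (\<lambda>\<omega>. if i = ?J \<omega> then b i else 0)" for i
      by (rule integrable_const_bound[where B = 1]) (use b in auto)
    have norm: "norm (if i = j then b i else 0) = (if i = j then b i else 0)" for i j using b by simp
    show "AE \<omega> in M. summable (\<lambda>i. norm (if i = ?J \<omega> then b i else 0))"
      unfolding norm by (intro AE_I2 sums_summable[OF sums_single])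
    have "summable (\<lambda>i. prob (A i))"
      by (rule sums_summable[OF finite_measure_UNION]) (auto simp: disjoint_family_on_def A_def)
    then have "summable (\<lambda>i. b i * prob (A i))"
    proof (rule summable_comparison_test'[where N = 0])
      show "norm (b i * prob (A i)) \<le> prob (A i)" for i
        using b[of i] measure_nonneg[of M "A i"] by (simp add: abs_mult mult_left_le_one_le)
    qed
    then show "summable (\<lambda>i. expectation (\<lambda>\<omega>. norm (if i = ?J \<omega> then b i else 0)))"
      by (simp only: norm E)
  qed
  moreover have "(\<Sum>i. if i = ?J \<omega> then b i else 0) = b (?J \<omega>)" for \<omega>
    by (rule sums_unique[symmetric, OF sums_single])
  ultimately show ?thesis by (simp only: E PA mult.commute)
qed

text \<open>Only the tail of the mixing variable enters: as \<open>level g d i\<close> is g/2 - i d,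
  the void probabilities at the levels are the tails of X at multiples of d. Both descriptions of
  the discrete count are then compared in the limit.\<close>

lemma (in record_process) prob_num_dominated_maxima:
  fixes L :: "'c measure" and X :: "'c \<Rightarrow> real"
  assumes "prob_space L" and X: "X \<in> borel_measurable L"
    and law: "\<And>t. t \<ge> 0 \<Longrightarrow> measure L {\<omega>\<in>space L. t \<le> X \<omega>} = right_void_prob g (g / 2 - t)"
  shows "prob {\<omega>\<in>space M. num_dominated_maxima g (\<Xi> \<omega>) = enat k}
    = (\<integral>\<omega>. exp (- X \<omega>) * X \<omega> ^ k / fact k \<partial>L)"
proof -
  interpret L: prob_space L by fact
  note X[measurable]
  let ?d = "\<lambda>n. 1 / real (Suc n)"
  let ?b = "\<lambda>n i. binom_prob (1 - exp (- ?d n)) i k"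
  have b: "0 \<le> ?b n i" "?b n i \<le> 1" for n i
    by (auto intro!: binom_prob_nonneg binom_prob_le_1)
  have pos: "AE \<omega> in L. 0 \<le> X \<omega>"
    using law[of 0] by (subst L.prob_Collect_eq_1[symmetric]) (simp_all add: right_void_prob_def)
  have "prob (\<Union>i. cell_records (?d n) i k) = L.expectation (\<lambda>\<omega>. ?b n (nat \<lfloor>X \<omega> / ?d n\<rfloor>))" for n
  proof (rule sums_unique2)
    show "(\<lambda>i. (right_void_prob g (level g (?d n) i) - right_void_prob g (level g (?d n) (Suc i))) * ?b n i)
        sums prob (\<Union>i. cell_records (?d n) i k)"
      by (rule sums_prob_cell_records) simp
    have meas: "measure L {\<omega>\<in>space L. real i * ?d n \<le> X \<omega>} = right_void_prob g (level g (?d n) i)" for i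
      unfolding level_def by (rule law) simp
    have "0 < ?d n" by simp
    from L.sums_expectation_discretized[OF X this b(1)[of n] b(2)[of n] pos]
    show "(\<lambda>i. (right_void_prob g (level g (?d n) i) - right_void_prob g (level g (?d n) (Suc i))) * ?b n i)
        sums L.expectation (\<lambda>\<omega>. ?b n (nat \<lfloor>X \<omega> / ?d n\<rfloor>))"
      by (simp only: meas)
  qed
  then have "(\<lambda>n. L.expectation (\<lambda>\<omega>. ?b n (nat \<lfloor>X \<omega> / ?d n\<rfloor>)))
      \<longlonglongrightarrow> prob {\<omega>\<in>space M. num_dominated_maxima g (\<Xi> \<omega>) = enat k}"
    using tendsto_prob_cell_records[of k] by simp
  moreover have "(\<lambda>n. L.expectation (\<lambda>\<omega>. ?b n (nat \<lfloor>X \<omega> / ?d n\<rfloor>)))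
      \<longlonglongrightarrow> L.expectation (\<lambda>\<omega>. exp (- X \<omega>) * X \<omega> ^ k / fact k)"
  proof (rule integral_dominated_convergence[where w = "\<lambda>_. 1"])
    show "AE \<omega> in L. (\<lambda>n. ?b n (nat \<lfloor>X \<omega> / ?d n\<rfloor>)) \<longlonglongrightarrow> exp (- X \<omega>) * X \<omega> ^ k / fact k"
      using pos
    proof eventually_elim
      case (elim \<omega>)
      have "(\<lambda>n. real (nat \<lfloor>X \<omega> / ?d n\<rfloor>) / real (Suc n)) \<longlonglongrightarrow> X \<omega>"
      proof (rule tendsto_sandwich)
        have fl: "X \<omega> * real (Suc n) - 1 \<le> real (nat \<lfloor>X \<omega> / ?d n\<rfloor>)"
            "real (nat \<lfloor>X \<omega> / ?d n\<rfloor>) \<le> X \<omega> * real (Suc n)" for n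
        proof -
          have "0 \<le> X \<omega> * real (Suc n)" using elim by simp
          then show "X \<omega> * real (Suc n) - 1 \<le> real (nat \<lfloor>X \<omega> / ?d n\<rfloor>)"
            "real (nat \<lfloor>X \<omega> / ?d n\<rfloor>) \<le> X \<omega> * real (Suc n)" by (simp_all del: of_nat_Suc)
        qed
        show "\<forall>\<^sub>F n in sequentially. X \<omega> - 1 / real (Suc n) \<le> real (nat \<lfloor>X \<omega> / ?d n\<rfloor>) / real (Suc n)"
        proof (intro always_eventually allI)
          fix n
          have "X \<omega> - 1 / real (Suc n) = (X \<omega> * real (Suc n) - 1) / real (Suc n)"
            by (simp add: diff_divide_distrib del: of_nat_Suc)
          also have "\<dots> \<le> real (nat \<lfloor>X \<omega> / ?d n\<rfloor>) / real (Suc n)"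
            by (intro divide_right_mono fl) simp
          finally show "X \<omega> - 1 / real (Suc n) \<le> real (nat \<lfloor>X \<omega> / ?d n\<rfloor>) / real (Suc n)" .
        qed
        show "\<forall>\<^sub>F n in sequentially. real (nat \<lfloor>X \<omega> / ?d n\<rfloor>) / real (Suc n) \<le> X \<omega>"
          using fl(2) by (intro always_eventually allI) (simp add: pos_divide_le_eq del: of_nat_Suc)
        show "(\<lambda>n. X \<omega> - 1 / real (Suc n)) \<longlonglongrightarrow> X \<omega>" by real_asymp
      qed simp
      then show ?case by (rule tendsto_binom_prob_poisson)
    qed
    show "AE \<omega> in L. norm (?b n (nat \<lfloor>X \<omega> / ?d n\<rfloor>)) \<le> 1" for n
      using b by simp
  qed simp_all
  ultimately show ?thesis by (rule LIMSEQ_unique)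
qed

section \<open>The Gumbel mixture\<close>

lemma gumbel_density_nonneg: "0 \<le> gumbel_density x"
  by (simp add: gumbel_density_def)

lemma gumbel_density_borel [measurable]: "gumbel_density \<in> borel_measurable borel"
  unfolding gumbel_density_def by measurable

lemma nn_integral_gumbel_density_atLeast:
  "(\<integral>\<^sup>+x. ennreal (gumbel_density x) * indicator {a..} x \<partial>lborel) = ennreal (1 - exp (- exp (- a)))"
proof (rule nn_integral_FTC_atLeast)
  show "((\<lambda>x. exp (- exp (- x))) has_real_derivative gumbel_density x) (at x)" for x
    by (auto intro!: derivative_eq_intros simp: gumbel_density_def)
  show "((\<lambda>x. exp (- exp (- x))) \<longlongrightarrow> (1 :: real)) at_top" by real_asymp
qed (simp_all add: gumbel_density_nonneg)

lemma nn_integral_gumbel_density_exp: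
  "(\<integral>\<^sup>+x. ennreal (gumbel_density x * exp (- x)) \<partial>lborel) = 1"
proof -
  \<comment> \<open>With u = e^(-x) the integral is that of u e^(-u) over the positive reals, and
    \<open>?F\<close> is (1 + u) e^(-u).\<close>
  let ?f = "\<lambda>x. gumbel_density x * exp (- x)" and ?F = "\<lambda>x. (1 + exp (- x)) * exp (- exp (- x)) :: real"
  have "(\<integral>\<^sup>+x. ennreal (?f x) * indicator {- real n..} x \<partial>lborel) = ennreal (1 - ?F (- real n))" for n
  proof (rule nn_integral_FTC_atLeast)
    show "(?F has_real_derivative ?f x) (at x)" for x
      by (auto intro!: derivative_eq_intros simp: gumbel_density_def algebra_simps)
    show "(?F \<longlongrightarrow> (1 :: real)) at_top" by real_asymp
  qed (simp_all add: gumbel_density_nonneg)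
  moreover have "(\<lambda>n. \<integral>\<^sup>+x. ennreal (?f x) * indicator {- real n..} x \<partial>lborel)
      \<longlonglongrightarrow> (\<integral>\<^sup>+x. ennreal (?f x) \<partial>lborel)"
  proof (rule nn_integral_LIMSEQ)
    show "incseq (\<lambda>n x. ennreal (?f x) * indicator {- real n..} x)"
      by (auto simp: incseq_def le_fun_def indicator_def)
    show "(\<lambda>n. ennreal (?f x) * indicator {- real n..} x) \<longlonglongrightarrow> ennreal (?f x)" for x
    proof (rule tendsto_eventually)
      obtain m :: nat where m: "- x < real m" using reals_Archimedean2 by blast
      show "\<forall>\<^sub>F n in sequentially. ennreal (?f x) * indicator {- real n..} x = ennreal (?f x)"
        using eventually_ge_at_top[of m]
      proof eventually_elim
        case (elim n)
        then have "real m \<le> real n" by simp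
        then have "- real n \<le> x" using m by linarith
        then show ?case by simp
      qed
    qed
  qed measurable
  moreover have "(\<lambda>n. ennreal (1 - ?F (- real n))) \<longlonglongrightarrow> ennreal 1"
  proof (rule tendsto_ennrealI)
    show "(\<lambda>n. 1 - ?F (- real n)) \<longlonglongrightarrow> 1" by real_asymp
  qed
  ultimately show ?thesis using LIMSEQ_unique by (simp add: ennreal_1)
qed

locale gumbel_variable = prob_space P for P :: "'b measure" +
  fixes G :: "'b \<Rightarrow> real"
  assumes G: "distributed P lborel G (\<lambda>x. ennreal (gumbel_density x))"
begin

lemma G_measurable [measurable]: "G \<in> borel_measurable P"
  using distributed_measurable[OF G] by simp

lemma prob_less_eq: "prob {\<omega>\<in>space P. G \<omega> < a} = exp (- exp (- a))"
  and prob_le_eq: "prob {\<omega>\<in>space P. G \<omega> \<le> a} = exp (- exp (- a))"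
proof -
  have ge: "prob {\<omega>\<in>space P. a \<le> G \<omega>} = 1 - exp (- exp (- a))"
  proof -
    have "emeasure P (G -` {a..} \<inter> space P) = ennreal (1 - exp (- exp (- a)))"
      by (subst distributed_emeasure[OF G]) (simp_all add: nn_integral_gumbel_density_atLeast)
    moreover have "G -` {a..} \<inter> space P = {\<omega>\<in>space P. a \<le> G \<omega>}" by auto
    ultimately show ?thesis by (simp add: emeasure_eq_measure)
  qed
  have gt: "prob {\<omega>\<in>space P. a < G \<omega>} = 1 - exp (- exp (- a))"
  proof -
    have "AE x in lborel. x \<noteq> a" by (rule AE_lborel_singleton)
    then have "(\<integral>\<^sup>+x. ennreal (gumbel_density x) * indicator {a<..} x \<partial>lborel)
        = (\<integral>\<^sup>+x. ennreal (gumbel_density x) * indicator {a..} x \<partial>lborel)"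
      by (intro nn_integral_cong_AE) (auto simp: indicator_def)
    then have "emeasure P (G -` {a<..} \<inter> space P) = ennreal (1 - exp (- exp (- a)))"
      by (subst distributed_emeasure[OF G]) (simp_all add: nn_integral_gumbel_density_atLeast)
    moreover have "G -` {a<..} \<inter> space P = {\<omega>\<in>space P. a < G \<omega>}" by auto
    ultimately show ?thesis by (simp add: emeasure_eq_measure)
  qed
  have "{\<omega>\<in>space P. G \<omega> < a} = space P - {\<omega>\<in>space P. a \<le> G \<omega>}" by auto
  then show "prob {\<omega>\<in>space P. G \<omega> < a} = exp (- exp (- a))"
    using ge by (simp add: prob_compl)
  have "{\<omega>\<in>space P. G \<omega> \<le> a} = space P - {\<omega>\<in>space P. a < G \<omega>}" by auto
  then show "prob {\<omega>\<in>space P. G \<omega> \<le> a} = exp (- exp (- a))"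
    using gt by (simp add: prob_compl)
qed

end

locale gumbel_overshoot = gumbel_variable P G + L: prob_space L
  for P :: "'b measure" and G :: "'b \<Rightarrow> real" and L :: "'c measure" +
  fixes \<Lambda> :: "'c \<Rightarrow> real" and g :: real
  assumes \<Lambda> [measurable]: "\<Lambda> \<in> borel_measurable L"
    and law: "distr L borel \<Lambda> = distr (uniform_measure P {\<omega> \<in> space P. g - G \<omega> > 0}) borel (\<lambda>\<omega>. g - G \<omega>)"
begin

lemma condition_eq: "{\<omega> \<in> space P. g - G \<omega> > 0} = {\<omega> \<in> space P. G \<omega> < g}"
  by auto

lemma nn_integral_overshoot:
  assumes [measurable]: "f \<in> borel_measurable borel"
  shows "(\<integral>\<^sup>+\<omega>. f (\<Lambda> \<omega>) \<partial>L)
    = (\<integral>\<^sup>+x. ennreal (gumbel_density x) * (f (g - x) * indicator {..<g} x) \<partial>lborel) / ennreal (exp (- exp (- g)))"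
proof -
  let ?A = "{\<omega> \<in> space P. G \<omega> < g}"
  have "(\<integral>\<^sup>+\<omega>. f (\<Lambda> \<omega>) \<partial>L) = (\<integral>\<^sup>+x. f x \<partial>distr L borel \<Lambda>)"
    by (simp add: nn_integral_distr)
  also have "\<dots> = (\<integral>\<^sup>+\<omega>. f (g - G \<omega>) \<partial>uniform_measure P ?A)"
    unfolding law condition_eq by (subst nn_integral_distr) simp_all
  also have "\<dots> = (\<integral>\<^sup>+\<omega>. f (g - G \<omega>) * indicator ?A \<omega> \<partial>P) / emeasure P ?A"
    by (rule nn_integral_uniform_measure) measurable
  also have "(\<integral>\<^sup>+\<omega>. f (g - G \<omega>) * indicator ?A \<omega> \<partial>P) = (\<integral>\<^sup>+\<omega>. f (g - G \<omega>) * indicator {..<g} (G \<omega>) \<partial>P)"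
    by (intro nn_integral_cong) (auto simp: indicator_def)
  also have "\<dots> = (\<integral>\<^sup>+x. ennreal (gumbel_density x) * (f (g - x) * indicator {..<g} x) \<partial>lborel)"
    by (rule distributed_nn_integral[OF G, symmetric]) measurable
  finally show ?thesis by (simp add: emeasure_eq_measure prob_less_eq)
qed

text \<open>Here the two models meet: since g/2 + (g/2 - t) = g - t, the ratio of the Gumbel
  probabilities at g - t and g is the void probability above height g/2 - t.\<close>

lemma prob_overshoot_ge:
  assumes "t \<ge> 0"
  shows "measure L {\<omega>\<in>space L. t \<le> \<Lambda> \<omega>} = right_void_prob g (g / 2 - t)"
proof -
  let ?A = "{\<omega> \<in> space P. G \<omega> < g}" and ?B = "{\<omega> \<in> space P. G \<omega> \<le> g - t}"
  have "{\<omega>\<in>space L. t \<le> \<Lambda> \<omega>} = \<Lambda> -` {t..} \<inter> space L" by auto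
  then have "measure L {\<omega>\<in>space L. t \<le> \<Lambda> \<omega>} = measure (distr L borel \<Lambda>) {t..}"
    by (simp add: measure_distr)
  also have "\<dots> = measure (uniform_measure P ?A) ((\<lambda>\<omega>. g - G \<omega>) -` {t..} \<inter> space P)"
    unfolding law condition_eq by (simp add: measure_distr)
  also have "(\<lambda>\<omega>. g - G \<omega>) -` {t..} \<inter> space P = ?B" by auto
  also have "measure (uniform_measure P ?A) ?B = prob (?A \<inter> ?B) / prob ?A"
    by (rule measure_uniform_measure) (simp_all add: emeasure_eq_measure prob_less_eq)
  also have "prob (?A \<inter> ?B) = exp (- exp (- (g - t)))"
  \<comment> \<open>For t = 0 the intersection is the strict event \<open>?A\<close>, otherwise it
    is \<open>?B\<close>; the formula is the same because G has no atoms.\<close>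
  proof (cases "t = 0")
    case True
    then have "?A \<inter> ?B = ?A" by auto
    then show ?thesis using True by (simp add: prob_less_eq)
  next
    case False
    then have "?A \<inter> ?B = ?B" using assms by auto
    then show ?thesis by (simp add: prob_le_eq)
  qed
  also have "exp (- exp (- (g - t))) / prob ?A = right_void_prob g (g / 2 - t)"
  proof -
    have "exp (- (g / 2)) * exp (- (g / 2 - t)) = exp (- (g - t))" "exp (- (g / 2)) * exp (- (g / 2)) = exp (- g)"
      unfolding exp_add[symmetric] by (simp_all add: algebra_simps)
    then show ?thesis
      by (simp only: prob_less_eq right_void_prob_def right_diff_distrib exp_diff[symmetric]) simp
  qed
  finally show ?thesis .
qed

lemma AE_overshoot_nonneg: "AE \<omega> in L. 0 \<le> \<Lambda> \<omega>"
  using prob_overshoot_ge[of 0] by (subst L.prob_Collect_eq_1[symmetric]) (simp_all add: right_void_prob_def)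

end

section \<open>Mixing over g and the geometric law\<close>

lemma poisson_weight_le_1:
  fixes x :: real
  assumes "x \<ge> 0" shows "exp (- x) * x ^ k / fact k \<le> 1"
proof (cases "x = 0")
  case False
  then have "0 < x" using assms by simp
  from pmf_le_1[of "poisson_pmf x" k] show ?thesis using \<open>0 < x\<close> by (simp add: mult.commute)
qed (simp add: power_0_left)

text \<open>The normalization 1 / P(G < g) of the conditional law cancels the factor exp (-e^(-g))
  of \<open>gumbel_density g\<close>, so only e^(-g) remains outside.\<close>

lemma (in gumbel_overshoot) poisson_mixture_weight:
  "ennreal ((\<integral>\<omega>. exp (- \<Lambda> \<omega>) * \<Lambda> \<omega> ^ k / fact k \<partial>L) * gumbel_density g)
    = (\<integral>\<^sup>+x. ennreal (gumbel_density x) *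
        (ennreal (exp (- (g - x)) * (g - x) ^ k / fact k) * indicator {..<g} x) * ennreal (exp (- g)) \<partial>lborel)"
proof -
  let ?f = "\<lambda>x. exp (- x) * x ^ k / fact k :: real"
  let ?I = "\<integral>\<^sup>+x. ennreal (gumbel_density x) * (ennreal (?f (g - x)) * indicator {..<g} x) \<partial>lborel"
  have nonneg: "AE \<omega> in L. 0 \<le> ?f (\<Lambda> \<omega>)"
    using AE_overshoot_nonneg by eventually_elim simp
  have "integrable L (\<lambda>\<omega>. ?f (\<Lambda> \<omega>))"
  proof (rule L.integrable_const_bound[where B = 1])
    show "AE \<omega> in L. norm (?f (\<Lambda> \<omega>)) \<le> 1"
      using AE_overshoot_nonneg nonneg
      by eventually_elim (simp only: real_norm_def abs_of_nonneg poisson_weight_le_1)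
  qed measurable
  then have "ennreal (\<integral>\<omega>. ?f (\<Lambda> \<omega>) \<partial>L) = (\<integral>\<^sup>+\<omega>. ennreal (?f (\<Lambda> \<omega>)) \<partial>L)"
    using nonneg by (rule nn_integral_eq_integral[symmetric])
  also have "\<dots> = ?I / ennreal (exp (- exp (- g)))"
    by (rule nn_integral_overshoot) measurable
  finally have mixture: "ennreal (\<integral>\<omega>. ?f (\<Lambda> \<omega>) \<partial>L) = ?I / ennreal (exp (- exp (- g)))" .
  have "0 \<le> (\<integral>\<omega>. ?f (\<Lambda> \<omega>) \<partial>L)"
    using nonneg by (rule integral_nonneg_AE)
  then have "ennreal ((\<integral>\<omega>. ?f (\<Lambda> \<omega>) \<partial>L) * gumbel_density g)
      = ?I / ennreal (exp (- exp (- g))) * ennreal (gumbel_density g)"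
    unfolding mixture[symmetric] by (rule ennreal_mult[OF _ gumbel_density_nonneg])
  also have "\<dots> = ?I * (ennreal (gumbel_density g) / ennreal (exp (- exp (- g))))"
    unfolding divide_ennreal_def by (simp only: mult_ac)
  also have "ennreal (gumbel_density g) / ennreal (exp (- exp (- g))) = ennreal (exp (- g))"
    by (subst divide_ennreal) (simp_all add: gumbel_density_def)
  also have "?I * ennreal (exp (- g)) = (\<integral>\<^sup>+x. ennreal (gumbel_density x) *
        (ennreal (?f (g - x)) * indicator {..<g} x) * ennreal (exp (- g)) \<partial>lborel)"
    by (rule nn_integral_multc[symmetric]) measurable
  finally show ?thesis .
qed

text \<open>The integrand is 2^(-(k+1)) times the Erlang density of rate 2. The two sides may differ
  at s = 0, hence the comparison almost everywhere.\<close>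

lemma nn_integral_gamma_2:
  "(\<integral>\<^sup>+s. ennreal (exp (- s) * s ^ k / fact k) * indicator {0<..} s * ennreal (exp (- s)) \<partial>lborel)
    = ennreal ((1 / 2) ^ Suc k)"
proof -
  have "AE s in lborel. s \<noteq> (0 :: real)" by (rule AE_lborel_singleton)
  then have "AE s in lborel. ennreal (exp (- s) * s ^ k / fact k) * indicator {0<..} s * ennreal (exp (- s))
      = ennreal ((1 / 2) ^ Suc k) * ennreal (erlang_density k 2 s)"
  proof eventually_elim
    case (elim s)
    have "exp (- (2 * s)) = exp (- s) * exp (- s)" by (simp add: exp_add[symmetric])
    then show ?case using elim
      by (cases "s > 0") (simp_all add: erlang_density_def ennreal_mult'[symmetric] power_one_over field_simps)
  qed
  then have "(\<integral>\<^sup>+s. ennreal (exp (- s) * s ^ k / fact k) * indicator {0<..} s * ennreal (exp (- s)) \<partial>lborel)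
      = ennreal ((1 / 2) ^ Suc k) * (\<integral>\<^sup>+s. ennreal (erlang_density k 2 s) \<partial>lborel)"
    by (subst nn_integral_cmult[symmetric]) (auto intro: nn_integral_cong_AE)
  also have "(\<integral>\<^sup>+s. ennreal (erlang_density k 2 s) \<partial>lborel) = 1"
    using prob_space.emeasure_space_1[OF prob_space_erlang_density[of 2 k]]
    by (simp add: emeasure_density)
  finally show ?thesis by simp
qed

text \<open>After Tonelli the substitution g = x + s splits e^(-g): e^(-x) joins the Gumbel density
  and integrates to 1, e^(-s) joins the Poisson weight and leaves 2^(-(k+1)).\<close>

lemma nn_integral_poisson_mixture_weight:
  "(\<integral>\<^sup>+g. \<integral>\<^sup>+x. ennreal (gumbel_density x) *
      (ennreal (exp (- (g - x)) * (g - x) ^ k / fact k) * indicator {..<g} x) * ennreal (exp (- g)) \<partial>lborel \<partial>lborel)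
    = ennreal ((1 / 2) ^ Suc k)"
proof -
  let ?f = "\<lambda>s. ennreal (exp (- s) * s ^ k / fact k)"
  \<comment> \<open>Written as a function of g - x, the indicator is visibly jointly measurable and
    turns into an indicator in s after the shift.\<close>
  have ind: "indicator {..<g} x = (indicator {0<..} (g - x) :: ennreal)" for g x :: real
    by (simp add: indicator_def)
  have "(\<integral>\<^sup>+g. \<integral>\<^sup>+x. ennreal (gumbel_density x) * (?f (g - x) * indicator {..<g} x) * ennreal (exp (- g)) \<partial>lborel \<partial>lborel)
      = (\<integral>\<^sup>+x. \<integral>\<^sup>+g. ennreal (gumbel_density x) * (?f (g - x) * indicator {0<..} (g - x)) * ennreal (exp (- g)) \<partial>lborel \<partial>lborel)"
    unfolding ind by (rule lborel_pair.Fubini'[symmetric]) measurable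
  also have "\<dots> = (\<integral>\<^sup>+x. ennreal (gumbel_density x * exp (- x)) * ennreal ((1 / 2) ^ Suc k) \<partial>lborel)"
  proof (rule nn_integral_cong)
    fix x :: real
    have "(\<integral>\<^sup>+g. ennreal (gumbel_density x) * (?f (g - x) * indicator {0<..} (g - x)) * ennreal (exp (- g)) \<partial>lborel)
        = (\<integral>\<^sup>+s. ennreal (gumbel_density x) * (?f s * indicator {0<..} s) * ennreal (exp (- (x + s))) \<partial>lborel)"
      by (subst nn_integral_real_affine[where c = 1 and t = x]) simp_all
    also have "\<dots> = (\<integral>\<^sup>+s. ennreal (gumbel_density x * exp (- x)) * (?f s * indicator {0<..} s * ennreal (exp (- s))) \<partial>lborel)"
    proof (rule nn_integral_cong)
      fix s :: real
      have "ennreal (exp (- (x + s))) = ennreal (exp (- x)) * ennreal (exp (- s))"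
        by (simp add: ennreal_mult[symmetric] exp_add[symmetric])
      then show "ennreal (gumbel_density x) * (?f s * indicator {0<..} s) * ennreal (exp (- (x + s)))
          = ennreal (gumbel_density x * exp (- x)) * (?f s * indicator {0<..} s * ennreal (exp (- s)))"
        by (simp only: ennreal_mult[OF gumbel_density_nonneg exp_ge_zero] mult_ac)
    qed
    also have "\<dots> = ennreal (gumbel_density x * exp (- x)) * ennreal ((1 / 2) ^ Suc k)"
      unfolding nn_integral_gamma_2[symmetric] by (rule nn_integral_cmult) measurable
    finally show "(\<integral>\<^sup>+g. ennreal (gumbel_density x) * (?f (g - x) * indicator {0<..} (g - x)) * ennreal (exp (- g)) \<partial>lborel)
        = ennreal (gumbel_density x * exp (- x)) * ennreal ((1 / 2) ^ Suc k)" .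
  qed
  also have "\<dots> = ennreal ((1 / 2) ^ Suc k)"
    by (subst nn_integral_multc) (simp_all add: nn_integral_gumbel_density_exp)
  finally show ?thesis .
qed

text \<open>The weights at finite values already sum to 1, so the value \<open>\<infinity>\<close>
  has probability 0 and both laws can be compared point by point.\<close>

lemma distr_eq_geometric:
  fixes K :: "'d \<Rightarrow> enat"
  assumes "prob_space N" and K: "K \<in> measurable N (count_space UNIV)"
    and PK: "\<And>k. measure N {\<omega> \<in> space N. K \<omega> = enat k} = (1 / 2) ^ Suc k"
  shows "distr N (count_space UNIV) K
    = distr (geometric1_pmf (1/2)) (count_space UNIV) (\<lambda>n. enat (n - 1))"
proof -
  interpret N: prob_space N by fact
  have E: "K -` {a} \<inter> space N \<in> N.events" for a
    using measurable_sets[OF K, of "{a}"] by simp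
  have vim: "K -` {a} \<inter> space N = {\<omega> \<in> space N. K \<omega> = a}" for a by auto
  have "(\<lambda>k. (1 / 2 :: real) ^ Suc k) sums 1"
    using power_half_series .
  moreover have "(\<lambda>k. N.prob {\<omega> \<in> space N. K \<omega> = enat k}) sums N.prob (\<Union>k. {\<omega> \<in> space N. K \<omega> = enat k})"
    using E[unfolded vim] by (intro N.finite_measure_UNION) (auto simp: disjoint_family_on_def)
  ultimately have fin: "N.prob (\<Union>k. {\<omega> \<in> space N. K \<omega> = enat k}) = 1"
    unfolding PK by (rule sums_unique2[symmetric])
  have "{\<omega> \<in> space N. K \<omega> = \<infinity>} = space N - (\<Union>k. {\<omega> \<in> space N. K \<omega> = enat k})"
  proof -
    have "n = \<infinity> \<longleftrightarrow> (\<forall>k. n \<noteq> enat k)" for n by (cases n) auto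
    then show ?thesis by auto
  qed
  then have inf: "N.prob {\<omega> \<in> space N. K \<omega> = \<infinity>} = 0"
    using fin E[unfolded vim] by (simp only:) (subst N.prob_compl, auto)
  \<comment> \<open>The subtraction n - 1 undoes the \<open>Suc\<close> in
    \<open>geometric1_pmf\<close>.\<close>
  have geo: "distr (geometric1_pmf (1/2)) (count_space UNIV) (\<lambda>n. enat (n - 1))
      = measure_pmf (map_pmf enat (geometric_pmf (1/2)))"
    unfolding map_pmf_rep_eq[symmetric] geometric1_pmf_def map_pmf_comp by simp
  show ?thesis
    unfolding geo
  proof (rule measure_eqI_countable[where A = UNIV])
    fix a :: enat
    have "emeasure (distr N (count_space UNIV) K) {a} = ennreal (N.prob {\<omega> \<in> space N. K \<omega> = a})"
      using K by (simp add: emeasure_distr vim N.emeasure_eq_measure)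
    also have "N.prob {\<omega> \<in> space N. K \<omega> = a} = pmf (map_pmf enat (geometric_pmf (1/2))) a"
    proof (cases a)
      case (enat k)
      have "pmf (map_pmf enat (geometric_pmf (1/2))) (enat k) = pmf (geometric_pmf (1/2)) k"
        by (rule pmf_map_inj') (simp add: inj_on_def)
      then show ?thesis by (simp add: enat PK)
    next
      case infinity
      have "pmf (map_pmf enat (geometric_pmf (1/2))) \<infinity> = 0"
        unfolding pmf_eq_0_set_pmf by auto
      then show ?thesis using inf by (simp only: infinity)
    qed
    also have "ennreal \<dots> = emeasure (measure_pmf (map_pmf enat (geometric_pmf (1/2)))) {a}"
      by (simp add: emeasure_pmf_single)
    finally show "emeasure (distr N (count_space UNIV) K) {a}
        = emeasure (measure_pmf (map_pmf enat (geometric_pmf (1/2)))) {a}" .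
  qed simp_all
qed

theorem corollary6p1:
  fixes M :: "real \<Rightarrow> 'a measure" and \<Xi> :: "real \<Rightarrow> 'a \<Rightarrow> (real \<times> real) set"
    and \<K> :: "real \<Rightarrow> 'a \<Rightarrow> enat"
    and P :: "'b measure" and G :: "'b \<Rightarrow> real"
    and L :: "real \<Rightarrow> 'c measure" and \<Lambda> :: "real \<Rightarrow> 'c \<Rightarrow> real"
    and N :: "'d measure" and K :: "'d \<Rightarrow> enat"
  assumes "\<And>g. poisson_process (M g) (intensity g) (\<Xi> g)"
    and "\<And>g \<omega>. \<K> g \<omega> = num_dominated_maxima g (\<Xi> g \<omega>)"
    and "prob_space P"
    and "distributed P lborel G (\<lambda>x. ennreal (gumbel_density x))"
    and "\<And>g. prob_space (L g)"
    and "\<And>g. \<Lambda> g \<in> borel_measurable (L g)"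
    and "\<And>g. distr (L g) borel (\<Lambda> g)
           = distr (uniform_measure P {\<omega> \<in> space P. g - G \<omega> > 0}) borel (\<lambda>\<omega>. g - G \<omega>)"
    and "prob_space N"
    and "K \<in> measurable N (count_space UNIV)"
    and "\<And>k::nat. measure N {\<omega> \<in> space N. K \<omega> = enat k}
           = (\<integral>g. measure (M g) {\<omega> \<in> space (M g). \<K> g \<omega> = enat k} * gumbel_density g \<partial>lborel)"
  shows "(\<forall>g. \<K> g \<in> measurable (M g) (count_space UNIV) \<and>
            (\<forall>k::nat. measure (M g) {\<omega> \<in> space (M g). \<K> g \<omega> = enat k}
               = (\<integral>\<omega>. exp (- \<Lambda> g \<omega>) * \<Lambda> g \<omega> ^ k / fact k \<partial>L g)))
       \<and> distr N (count_space UNIV) K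
           = distr (geometric1_pmf (1/2)) (count_space UNIV) (\<lambda>n. enat (n - 1))"
proof -
  interpret R: record_process "M g" g "\<Xi> g" for g
    by standard (rule assms(1))
  interpret G: gumbel_overshoot P G "L g" "\<Lambda> g" g for g
    using assms(3-7) by (simp add: gumbel_overshoot_def gumbel_variable_def
      gumbel_variable_axioms_def gumbel_overshoot_axioms_def)
  have K_eq: "\<K> g = (\<lambda>\<omega>. num_dominated_maxima g (\<Xi> g \<omega>))" for g
    using assms(2) by (rule ext)
  have meas: "\<K> g \<in> measurable (M g) (count_space UNIV)" for g
    unfolding K_eq by (rule R.measurable_num_dominated_maxima)
  have prob: "measure (M g) {\<omega> \<in> space (M g). \<K> g \<omega> = enat k}
      = (\<integral>\<omega>. exp (- \<Lambda> g \<omega>) * \<Lambda> g \<omega> ^ k / fact k \<partial>L g)" for g k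
    unfolding K_eq using assms(5,6) G.prob_overshoot_ge by (rule R.prob_num_dominated_maxima)
  have "measure N {\<omega> \<in> space N. K \<omega> = enat k} = (1 / 2) ^ Suc k" for k
  proof -
    let ?h = "\<lambda>g. measure (M g) {\<omega> \<in> space (M g). \<K> g \<omega> = enat k} * gumbel_density g"
    let ?w = "\<lambda>g. \<integral>\<^sup>+x. ennreal (gumbel_density x) *
      (ennreal (exp (- (g - x)) * (g - x) ^ k / fact k) * indicator {..<g} x) * ennreal (exp (- g)) \<partial>lborel"
    have h_w: "ennreal (?h g) = ?w g" for g
      unfolding prob by (rule G.poisson_mixture_weight)
    have h_nonneg: "0 \<le> ?h g" for g by (simp add: gumbel_density_nonneg)
    have ind: "indicator {..<g} x = (indicator {0<..} (g - x) :: ennreal)" for g x :: real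
      by (simp add: indicator_def)
    \<comment> \<open>The spaces \<open>M g\<close> are unrelated for different g, so measurability
      of \<open>?h\<close> in g cannot come from them; it is inherited from the closed form
      \<open>?w\<close>.\<close>
    have "?w \<in> borel_measurable borel"
      unfolding ind by measurable
    then have "(\<lambda>g. enn2real (?w g)) \<in> borel_measurable borel" by measurable
    moreover have "?h = (\<lambda>g. enn2real (?w g))"
      unfolding h_w[symmetric] using h_nonneg by simp
    ultimately have "?h \<in> borel_measurable lborel" by simp
    then have "(\<integral>g. ?h g \<partial>lborel) = enn2real (\<integral>\<^sup>+g. ennreal (?h g) \<partial>lborel)"
      using h_nonneg by (intro integral_eq_nn_integral) simp_all
    also have "\<dots> = (1 / 2) ^ Suc k"
      unfolding h_w nn_integral_poisson_mixture_weight by simp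
    finally show ?thesis unfolding assms(10) .
  qed
  then have "distr N (count_space UNIV) K
      = distr (geometric1_pmf (1/2)) (count_space UNIV) (\<lambda>n. enat (n - 1))"
    using assms(8,9) by (intro distr_eq_geometric)
  then show ?thesis using meas prob by blast
qed

end
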